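(* Let $\{(\mathbf x^k,y^k,\lambda^k)\}$ be generated by ADMM-LQP with $\beta>0$, $0<\mu<1$ and $(\alpha,\tau)\in\mathcal K$, and suppose that for some $\gamma>\frac{p-1}{1-\mu}$ one has $r_i\ge\gamma\beta\|A_i^{\sf T}A_i\|$ for $i=1,\dots,p$. Then there is a constant $\vartheta>0$, independent of $k$ and depending on the problem data and the parameters of ADMM-LQP (including its starting point), such that for any integer $k>0$ there exists an integer $t$ with $1\le t\le k$ and $$\|\mathbf x^t-\mathbf x^{t-1}\|^2\le\frac{\vartheta}{k}\quad\text{and}\quad\|y^t-y^{t-1}\|^2\le\frac{\vartheta}{k}.$$
   Context: Problem. Let $p\ge1$ be an integer, $A_i\in\mathbb R^{n\times m_i}$ ($i=1,\dots,p$) and $B\in\mathbb R^{n\times d}$ matrices of full column rank, $b\in\mathbb R^n$, $f_i:\mathbb R_+^{m_i}\to\mathbb R$ and $g:\mathbb R^d\to\mathbb R$ closed proper convex functions, $\mathcal Y\subset\mathbb R^d$ a closed convex set. The problem is: minimize $\sum_{i=1}^pf_i(x_i)+g(y)$ subject to $\sum_{i=1}^pA_ix_i+By=b$, $x_i\in\mathbb R_+^{m_i}$, $y\in\mathcal Y$; its solution set is assumed nonempty. Write $A=(A_1,\dots,A_p)$, $\mathbf x=(x_1;\dots;x_p)$, $\mathcal X=\mathbb R_+^{m_1}\times\cdots\times\mathbb R_+^{m_p}$, $\mathcal W=\mathcal X\times\mathcal Y\times\mathbb R^n$, $\mathbf w=(\mathbf x,y,\lambda)$, $\Theta(\mathbf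 w)=\sum_{i=1}^pf_i(x_i)+g(y)$ and $\mathcal J(\mathbf w)=(-A^{\sf T}\lambda;\,-B^{\sf T}\lambda;\,A\mathbf x+By-b)$. The set $\mathcal W^*$ of those $\mathbf w^*\in\mathcal W$ with $\Theta(\mathbf w)-\Theta(\mathbf w^* )+\langle\mathbf w-\mathbf w^*,\mathcal J(\mathbf w^* )\rangle\ge0$ for all $\mathbf w\in\mathcal W$ is nonempty. Augmented Lagrangian: $\mathcal L_\beta(\mathbf x,y,\lambda)=\sum_if_i(x_i)+g(y)-\langle\lambda,A\mathbf x+By-b\rangle+\frac\beta2\|A\mathbf x+By-b\|^2$. LQP regularizer: for fixed $0<\mu<1$ and $z\in\mathbb R_{++}^m$, $d(v,z)=\sum_{j=1}^m\big[\frac12(v_j-z_j)^2+\mu(z_j^2\log\frac{z_j}{v_j}+v_jz_j-z_j^2)\big]$ if $v\in\mathbb R_{++}^m$, and $+\infty$ otherwise. $\mathcal K=\{(\alpha,\tau): -1<\alpha<1,\ \alpha+\tau>0,\ 1+\alpha+\tau-\alpha\tau-\alpha^2-\tau^2>0\}$. ADMM-LQP. Given $\beta>0$, $r_i>0$, $(\alpha,\tau)\in\mathcal K$ and a starting point $(x_1^0,\dots,x_p^0,y^0,\lambda^0)$ with $x_i^0\in\mathbb R_{++}^{m_i}$ (so that $d$ is defined), for $k=0,1,2,\dots$: $x_i^{k+1}=\arg\min_{x_i\in\mathbb R_+^{m_i}}\mathcal L_\beta(x_1^k,\dots,x_{i-1}^k,x_i,x_{i+1}^k,\dots,x_p^k,y^k,\lambda^k)+r_id(x_i,x_i^k)$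 for $i=1,\dots,p$; $\lambda^{k+\frac12}=\lambda^k-\alpha\beta(A\mathbf x^{k+1}+By^k-b)$; $y^{k+1}=\arg\min_{y\in\mathcal Y}\mathcal L_\beta(\mathbf x^{k+1},y,\lambda^{k+\frac12})$; $\lambda^{k+1}=\lambda^{k+\frac12}-\tau\beta(A\mathbf x^{k+1}+By^{k+1}-b)$. For matrices, $\|\cdot\|$ is the norm induced by the Euclidean norm. *)

theory Defs
  imports "HOL-Analysis.Analysis"
begin

text \<open>
  The block dimensions \<open>m\<^sub>1, \<dots>, m\<^sub>p\<close> may differ from each other. The space of the \<open>i\<close>-th block is
  represented as the coordinate subspace of \<open>real^'m\<close> of the vectors vanishing outside a set
  \<open>I i\<close> of \<open>m\<^sub>i\<close> indices, and the \<open>i\<close>-th block of the matrix as a matrix in \<open>real^'m^'n\<close> whose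
  columns outside \<open>I i\<close> vanish. Since the index type is arbitrary, this covers all families of
  dimensions, and inner products, norms, the rank and the induced norm are those of
  the actual blocks. A stacked vector \<open>(x\<^sub>1; \<dots>; x\<^sub>p)\<close> is a function \<open>x :: nat \<Rightarrow> real^'m\<close>, of
  which only the values on \<open>{1..p}\<close> matter.
\<close>

definition orthant :: "'m set \<Rightarrow> (real^'m) set" where
  "orthant I = {v. (\<forall>j\<in>I. 0 \<le> v $ j) \<and> (\<forall>j. j \<notin> I \<longrightarrow> v $ j = 0)}"

definition pos_orthant :: "'m set \<Rightarrow> (real^'m) set" where
  "pos_orthant I = {v. (\<forall>j\<in>I. 0 < v $ j) \<and> (\<forall>j. j \<notin> I \<longrightarrow> v $ j = 0)}"

text \<open>
  For a function with real values on its effective domain \<open>S\<close>, and \<open>+\<infinity>\<close> elsewhere, properness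
  says that \<open>S\<close> is nonempty.
\<close>

definition closed_proper_convex_on :: "'a::euclidean_space set \<Rightarrow> ('a \<Rightarrow> real) \<Rightarrow> bool" where
  "closed_proper_convex_on S f \<longleftrightarrow> S \<noteq> {} \<and> convex_on S f \<and> closed (epigraph S f)"

definition residual ::
  "nat \<Rightarrow> (nat \<Rightarrow> real^'m^'n) \<Rightarrow> real^'d^'n \<Rightarrow> real^'n \<Rightarrow> (nat \<Rightarrow> real^'m) \<Rightarrow> real^'d \<Rightarrow> real^'n" where
  "residual p A B b x y = (\<Sum>i\<in>{1..p}. A i *v x i) + B *v y - b"

definition objective ::
  "nat \<Rightarrow> (nat \<Rightarrow> real^'m \<Rightarrow> real) \<Rightarrow> (real^'d \<Rightarrow> real) \<Rightarrow> (nat \<Rightarrow> real^'m) \<Rightarrow> real^'d \<Rightarrow> real" where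
  "objective p f g x y = (\<Sum>i\<in>{1..p}. f i (x i)) + g y"

definition solutions ::
  "nat \<Rightarrow> (nat \<Rightarrow> 'm set) \<Rightarrow> (nat \<Rightarrow> real^'m^'n) \<Rightarrow> real^'d^'n \<Rightarrow> real^'n \<Rightarrow>
   (nat \<Rightarrow> real^'m \<Rightarrow> real) \<Rightarrow> (real^'d \<Rightarrow> real) \<Rightarrow> (real^'d) set \<Rightarrow> ((nat \<Rightarrow> real^'m) \<times> (real^'d)) set" where
  "solutions p I A B b f g Y =
     {(x, y). is_arg_min (\<lambda>(x, y). objective p f g x y)
        (\<lambda>(x, y). (\<forall>i\<in>{1..p}. x i \<in> orthant (I i)) \<and> y \<in> Y \<and> residual p A B b x y = 0) (x, y)}"

text \<open>
  The solution set of the variational inequality; the pairing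
  \<open>\<langle>w' - w, J w\<rangle>\<close> is written out component by component.
\<close>

definition VI_solutions ::
  "nat \<Rightarrow> (nat \<Rightarrow> 'm set) \<Rightarrow> (nat \<Rightarrow> real^'m^'n) \<Rightarrow> real^'d^'n \<Rightarrow> real^'n \<Rightarrow>
   (nat \<Rightarrow> real^'m \<Rightarrow> real) \<Rightarrow> (real^'d \<Rightarrow> real) \<Rightarrow> (real^'d) set \<Rightarrow>
   ((nat \<Rightarrow> real^'m) \<times> (real^'d) \<times> (real^'n)) set" where
  "VI_solutions p I A B b f g Y =
     {(x, y, l). (\<forall>i\<in>{1..p}. x i \<in> orthant (I i)) \<and> y \<in> Y \<and>
        (\<forall>x' y' l'. (\<forall>i\<in>{1..p}. x' i \<in> orthant (I i)) \<and> y' \<in> Y \<longrightarrow>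
           objective p f g x' y' - objective p f g x y
           + ((\<Sum>i\<in>{1..p}. (x' i - x i) \<bullet> - (transpose (A i) *v l))
              + (y' - y) \<bullet> - (transpose B *v l)
              + (l' - l) \<bullet> residual p A B b x y) \<ge> 0)}"

definition aug_lagrangian ::
  "nat \<Rightarrow> (nat \<Rightarrow> real^'m^'n) \<Rightarrow> real^'d^'n \<Rightarrow> real^'n \<Rightarrow> (nat \<Rightarrow> real^'m \<Rightarrow> real) \<Rightarrow>
   (real^'d \<Rightarrow> real) \<Rightarrow> real \<Rightarrow> (nat \<Rightarrow> real^'m) \<Rightarrow> real^'d \<Rightarrow> real^'n \<Rightarrow> real" where
  "aug_lagrangian p A B b f g \<beta> x y l =
     objective p f g x y - l \<bullet> residual p A B b x y
     + \<beta> / 2 * (norm (residual p A B b x y))\<^sup>2"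

definition lqp :: "real \<Rightarrow> 'm set \<Rightarrow> real^'m \<Rightarrow> real^'m \<Rightarrow> ereal" where
  "lqp \<mu> I v z =
     (if v \<in> pos_orthant I
      then ereal (\<Sum>j\<in>I. 1 / 2 * (v $ j - z $ j)\<^sup>2
             + \<mu> * ((z $ j)\<^sup>2 * ln (z $ j / v $ j) + v $ j * z $ j - (z $ j)\<^sup>2))
      else \<infinity>)"

definition stepsizes :: "(real \<times> real) set" where
  "stepsizes = {(\<alpha>, \<tau>). - 1 < \<alpha> \<and> \<alpha> < 1 \<and> \<alpha> + \<tau> > 0 \<and>
                 1 + \<alpha> + \<tau> - \<alpha> * \<tau> - \<alpha>\<^sup>2 - \<tau>\<^sup>2 > 0}"

text \<open>
  The argument vectors in \<open>is_arg_min\<close> range over the feasible set only, so \<open>f\<close> is never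
  evaluated outside its domain; the value \<open>\<infinity>\<close> of \<open>lqp\<close> forces the blocks of every
  iterate to be strictly positive. The local \<open>lh\<close> is the half-step multiplier.
\<close>

definition admm_lqp ::
  "nat \<Rightarrow> (nat \<Rightarrow> 'm set) \<Rightarrow> (nat \<Rightarrow> real^'m^'n) \<Rightarrow> real^'d^'n \<Rightarrow> real^'n \<Rightarrow>
   (nat \<Rightarrow> real^'m \<Rightarrow> real) \<Rightarrow> (real^'d \<Rightarrow> real) \<Rightarrow> (real^'d) set \<Rightarrow>
   real \<Rightarrow> real \<Rightarrow> (nat \<Rightarrow> real) \<Rightarrow> real \<Rightarrow> real \<Rightarrow>
   (nat \<Rightarrow> real^'m) \<Rightarrow> real^'d \<Rightarrow> real^'n \<Rightarrow>
   (nat \<Rightarrow> nat \<Rightarrow> real^'m) \<Rightarrow> (nat \<Rightarrow> real^'d) \<Rightarrow> (nat \<Rightarrow> real^'n) \<Rightarrow> bool" where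
  "admm_lqp p I A B b f g Y \<beta> \<mu> r \<alpha> \<tau> x0 y0 l0 x y l \<longleftrightarrow>
     (\<forall>i\<in>{1..p}. x 0 i = x0 i) \<and> y 0 = y0 \<and> l 0 = l0 \<and>
     (\<forall>k.
        (\<forall>i\<in>{1..p}.
           is_arg_min
             (\<lambda>v. ereal (aug_lagrangian p A B b f g \<beta> ((x k)(i := v)) (y k) (l k))
                  + ereal (r i) * lqp \<mu> (I i) v (x k i))
             (\<lambda>v. v \<in> orthant (I i)) (x (Suc k) i)) \<and>
        (let lh = l k - (\<alpha> * \<beta>) *\<^sub>R residual p A B b (x (Suc k)) (y k)
         in is_arg_min (\<lambda>v. aug_lagrangian p A B b f g \<beta> (x (Suc k)) v lh) (\<lambda>v. v \<in> Y) (y (Suc k)) \<and>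
            l (Suc k) = lh - (\<tau> * \<beta>) *\<^sub>R residual p A B b (x (Suc k)) (y (Suc k))))"

end

theory Submission
  imports Defs
begin

text \<open>
  The proof exhibits a Lyapunov function. Let \<open>R\<close> be the residual after a full iteration,
  \<open>\<delta> = B (y\<^sup>+ - y)\<close>, and let \<open>M = \<lambda> - \<lambda>\<^sup>* - \<alpha>\<beta> B (y - y\<^sup>*)\<close>, a combination chosen so that
  \<open>M\<^sup>+ = M - (\<alpha> + \<tau>) \<beta> R\<close>. The variational inequalities of the subproblems, tested
  with a saddle point, make an energy in \<open>x - x\<^sup>*\<close>, \<open>B (y - y\<^sup>*)\<close> and \<open>M\<close> decrease by a positive definite
  form in \<open>x\<^sup>+ - x\<close> (here the bound on \<open>r\<^sub>i\<close> enters) plus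
  \<open>\<beta> ((1 - (\<alpha> + \<tau>) / 2) |R|\<^sup>2 - (1 - \<alpha>) \<langle>R, \<delta>\<rangle> + (1 - \<alpha>) |\<delta>|\<^sup>2 / 2)\<close>.
  For large \<open>\<tau>\<close> the latter form is indefinite; the optimality conditions of two
  consecutive \<open>y\<close>-steps trade \<open>\<langle>R, \<delta>\<rangle>\<close> for the previous residual, and after adding a multiple
  of \<open>|R|\<^sup>2\<close> to the energy the required discriminant condition is exactly the one that defines
  \<open>stepsizes\<close>. Hence the squared steps are summable from the second iteration on. The first step
  is excluded because \<open>y\<^sup>0\<close> need not satisfy any optimality condition, but it is determined by the
  starting point, which makes the bound on the whole sum uniform over all runs.
\<close>

section \<open>First-order conditions along segments\<close>

text \<open>\<open>F\<close> may be nonsmooth, so only the smooth part \<open>H\<close> is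
  differentiated: convexity bounds the difference quotients of \<open>F\<close> by
  \<open>F u - F v\<close>, and t tends to 0 from the right. Comparing only for t strictly between 0
  and 1 allows an endpoint \<open>u\<close> at which the full objective is infinite.\<close>

lemma minimizer_on_segment:
  fixes F :: "'a::real_vector \<Rightarrow> real"
  assumes F: "convex_on C F" and vu: "v \<in> C" "u \<in> C"
    and H: "(H has_real_derivative D) (at 0)"
    and min: "\<And>t. 0 < t \<Longrightarrow> t < 1 \<Longrightarrow> F v + H 0 \<le> F (v + t *\<^sub>R (u - v)) + H t"
  shows "0 \<le> F u - F v + D"
proof -
  have lim: "((\<lambda>t. (H t - H 0) / t) \<longlongrightarrow> D) (at_right 0)"
    using H by (auto simp: has_field_derivative_iff intro: tendsto_within_subset)
  have "\<forall>\<^sub>F t in at_right 0. - (F u - F v) \<le> (H t - H 0) / t"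
    unfolding eventually_at_right_field
  proof (intro exI[of _ 1] conjI allI impI)
    fix t :: real assume t: "0 < t" "t < 1"
    have "F ((1 - t) *\<^sub>R v + t *\<^sub>R u) \<le> (1 - t) * F v + t * F u"
      using t by (intro convex_onD[OF F] vu) auto
    moreover have "(1 - t) *\<^sub>R v + t *\<^sub>R u = v + t *\<^sub>R (u - v)"
      by (simp add: algebra_simps)
    ultimately have "F v + H 0 \<le> (1 - t) * F v + t * F u + H t"
      using min[OF t] by simp
    then show "- (F u - F v) \<le> (H t - H 0) / t"
      using t by (subst pos_le_divide_eq) (auto simp: algebra_simps)
  qed simp
  then have "- (F u - F v) \<le> D"
    by (intro tendsto_lowerbound[OF lim]) auto
  then show ?thesis by simp
qed

lemma quadratic_path_derivative:
  fixes l w e :: "'a::real_inner"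
  shows "((\<lambda>t. - (l \<bullet> (e + t *\<^sub>R w)) + \<beta> / 2 * (norm (e + t *\<^sub>R w))\<^sup>2)
           has_real_derivative w \<bullet> (\<beta> *\<^sub>R e - l)) (at 0)"
proof -
  have "(\<lambda>t. - (l \<bullet> (e + t *\<^sub>R w)) + \<beta> / 2 * (norm (e + t *\<^sub>R w))\<^sup>2)
      = (\<lambda>t. - (l \<bullet> e) - t * (l \<bullet> w) + \<beta> / 2 * (e \<bullet> e + 2 * t * (e \<bullet> w) + t\<^sup>2 * (w \<bullet> w)))"
    unfolding power2_norm_eq_inner
    by (rule ext)
       (simp add: inner_add_left inner_add_right inner_commute[of w e] power2_eq_square
         distrib_left distrib_right)
  then show ?thesis
    by (auto intro!: derivative_eq_intros simp: inner_commute algebra_simps)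
qed

section \<open>The LQP regularizer and the subproblem inequalities\<close>

text \<open>The derivative in \<open>v\<close> of one coordinate summand of
  \<open>lqp\<close>.\<close>

definition lqp_slope :: "real \<Rightarrow> real \<Rightarrow> real \<Rightarrow> real" where
  "lqp_slope \<mu> v z = (v - z) + \<mu> * (z - z\<^sup>2 / v)"

text \<open>The singular quotient is removed by z^2/v >= 2z - v, a rewriting of (z - v)^2 / v >= 0;
  multiplying it by \<open>u\<close> is where the sign of \<open>u\<close> enters. What remains is a
  quadratic identity. The logarithmic part costs \<mu> in the coefficient of (v - z)^2, which is the
  origin of 1 - \<mu> in the condition on \<gamma>.\<close>

lemma lqp_slope_three_point:
  assumes v: "0 < v" and u: "0 \<le> u" and \<mu>: "0 < \<mu>"
  shows "(v - u) * lqp_slope \<mu> v z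
    \<ge> (1 + \<mu>) / 2 * ((v - u)\<^sup>2 - (z - u)\<^sup>2) + (1 - \<mu>) / 2 * (v - z)\<^sup>2"
proof -
  have "0 \<le> (z - v)\<^sup>2 / v" using v by simp
  also have "(z - v)\<^sup>2 / v = z\<^sup>2 / v - 2 * z + v"
    using v by (simp add: field_simps power2_eq_square)
  finally have "u * (2 * z - v) \<le> u * (z\<^sup>2 / v)"
    using u by (intro mult_left_mono) auto
  moreover have "(v - u) * (z - z\<^sup>2 / v) = v * z - z\<^sup>2 - u * z + u * (z\<^sup>2 / v)"
    using v by (simp add: field_simps)
  moreover have "(z - v) * (u - z) = z * u - z\<^sup>2 - v * u + v * z"
    by (simp add: algebra_simps power2_eq_square)
  ultimately have "(v - u) * (z - z\<^sup>2 / v) \<ge> (z - v) * (u - z)"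
    by (simp add: algebra_simps)
  then have "\<mu> * ((z - v) * (u - z)) \<le> \<mu> * ((v - u) * (z - z\<^sup>2 / v))"
    using \<mu> by (intro mult_left_mono) auto
  moreover have "(1 + \<mu>) / 2 * ((v - u)\<^sup>2 - (z - u)\<^sup>2) + (1 - \<mu>) / 2 * (v - z)\<^sup>2
      = (v - u) * (v - z) + \<mu> * ((z - v) * (u - z))"
    by (simp add: power2_eq_square field_simps)
  ultimately show ?thesis
    by (simp add: lqp_slope_def algebra_simps)
qed

text \<open>The quadratic part contributes modulus 1 and the term -z^2/v is itself increasing in
  \<open>v\<close>. This strong monotonicity makes the minimizer of an x-subproblem unique.\<close>

lemma lqp_slope_monotone:
  assumes "0 < v" "0 < v'" "0 < \<mu>"
  shows "(v - v')\<^sup>2 \<le> (v - v') * (lqp_slope \<mu> v z - lqp_slope \<mu> v' z)"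
proof -
  have "(v - v') * (lqp_slope \<mu> v z - lqp_slope \<mu> v' z)
      = (v - v')\<^sup>2 + \<mu> * z\<^sup>2 * (v - v')\<^sup>2 / (v * v')"
    using assms by (simp add: lqp_slope_def field_simps power2_eq_square)
  moreover have "0 \<le> \<mu> * z\<^sup>2 * (v - v')\<^sup>2 / (v * v')" using assms by simp
  ultimately show ?thesis by simp
qed

lemma lqp_path_derivative:
  fixes v z :: "real^'m::finite"
  assumes v: "v \<in> pos_orthant I" and z: "z \<in> pos_orthant I"
  shows "((\<lambda>t. \<Sum>j\<in>I. 1 / 2 * ((v + t *\<^sub>R w) $ j - z $ j)\<^sup>2
            + \<mu> * ((z $ j)\<^sup>2 * ln (z $ j / (v + t *\<^sub>R w) $ j) + (v + t *\<^sub>R w) $ j * z $ j - (z $ j)\<^sup>2))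
          has_real_derivative (\<Sum>j\<in>I. w $ j * lqp_slope \<mu> (v $ j) (z $ j))) (at 0)"
proof (intro DERIV_sum)
  fix j assume "j \<in> I"
  then have "0 < v $ j" "0 < z $ j" using v z by (auto simp: pos_orthant_def)
  then show "((\<lambda>t. 1 / 2 * ((v + t *\<^sub>R w) $ j - z $ j)\<^sup>2
            + \<mu> * ((z $ j)\<^sup>2 * ln (z $ j / (v + t *\<^sub>R w) $ j) + (v + t *\<^sub>R w) $ j * z $ j - (z $ j)\<^sup>2))
          has_real_derivative w $ j * lqp_slope \<mu> (v $ j) (z $ j)) (at 0)"
    by (auto intro!: derivative_eq_intros simp: lqp_slope_def field_simps power2_eq_square)
qed

lemma pos_orthant_subset: "pos_orthant I \<subseteq> orthant I"
  by (auto simp: orthant_def pos_orthant_def less_imp_le)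

lemma pos_orthant_segment:
  assumes v: "v \<in> pos_orthant I" and u: "u \<in> orthant I" and t: "0 < t" "t < 1"
  shows "v + t *\<^sub>R (u - v) \<in> pos_orthant I"
proof -
  have eq: "(v + t *\<^sub>R (u - v)) $ j = (1 - t) * v $ j + t * u $ j" for j
    by (simp add: algebra_simps)
  show ?thesis
    unfolding pos_orthant_def
  proof (intro CollectI conjI ballI allI impI)
    fix j assume "j \<in> I"
    then have "0 < (1 - t) * v $ j" "0 \<le> t * u $ j"
      using v u t by (auto simp: pos_orthant_def orthant_def)
    then show "0 < (v + t *\<^sub>R (u - v)) $ j" unfolding eq by linarith
  next
    fix j assume "j \<notin> I"
    then show "(v + t *\<^sub>R (u - v)) $ j = 0"
      using v u by (auto simp: pos_orthant_def orthant_def)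
  qed
qed

lemma quadratic_minimizer_VI:
  fixes A :: "real^'m::finite^'n::finite"
  assumes F: "convex_on C F"
    and min: "is_arg_min (\<lambda>v. F v + c + (- (l \<bullet> (A *v v + e)) + \<beta> / 2 * (norm (A *v v + e))\<^sup>2))
               (\<lambda>v. v \<in> C) v"
    and u: "u \<in> C"
  shows "0 \<le> F u - F v + (A *v (u - v)) \<bullet> (\<beta> *\<^sub>R (A *v v + e) - l)"
proof -
  have v: "v \<in> C" using min by (simp add: is_arg_min_def)
  have path: "A *v (v + t *\<^sub>R (u - v)) + e = (A *v v + e) + t *\<^sub>R (A *v (u - v))" for t
    by (simp add: matrix_vector_right_distrib matrix_vector_mult_scaleR)
  show ?thesis
  proof (rule minimizer_on_segment[OF F v u quadratic_path_derivative])
    fix t :: real assume t: "0 < t" "t < 1"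
    have "(1 - t) *\<^sub>R v + t *\<^sub>R u \<in> C"
      using convex_on_imp_convex[OF F] u v t by (intro convexD) auto
    then have "v + t *\<^sub>R (u - v) \<in> C" by (simp add: algebra_simps)
    then show "F v + (- (l \<bullet> (A *v v + e + 0 *\<^sub>R (A *v (u - v))))
          + \<beta> / 2 * (norm (A *v v + e + 0 *\<^sub>R (A *v (u - v))))\<^sup>2)
       \<le> F (v + t *\<^sub>R (u - v)) + (- (l \<bullet> (A *v v + e + t *\<^sub>R (A *v (u - v))))
          + \<beta> / 2 * (norm (A *v v + e + t *\<^sub>R (A *v (u - v))))\<^sup>2)"
      using min unfolding is_arg_min_linorder path[symmetric] by fastforce
  qed
qed

text \<open>\<open>e\<close> collects the part of the residual that does not depend on the block,
  and \<open>c\<close> the objective terms of the other blocks. The test point \<open>u\<close> may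
  lie on the boundary of the orthant, as the components of a saddle point can vanish.\<close>

lemma lqp_minimizer:
  fixes A :: "real^'m::finite^'n::finite"
  assumes F: "convex_on (orthant I) F" and r: "0 < r" and z: "z \<in> pos_orthant I"
    and min: "is_arg_min
      (\<lambda>v. ereal (F v + c + (- (l \<bullet> (A *v v + e)) + \<beta> / 2 * (norm (A *v v + e))\<^sup>2))
        + ereal r * lqp \<mu> I v z) (\<lambda>v. v \<in> orthant I) v"
  shows lqp_minimizer_pos: "v \<in> pos_orthant I"
    and lqp_minimizer_VI: "u \<in> orthant I \<Longrightarrow>
      0 \<le> F u - F v + (A *v (u - v)) \<bullet> (\<beta> *\<^sub>R (A *v v + e) - l)
          + r * (\<Sum>j\<in>I. (u $ j - v $ j) * lqp_slope \<mu> (v $ j) (z $ j))"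
proof -
  let ?q = "\<lambda>v. - (l \<bullet> (A *v v + e)) + \<beta> / 2 * (norm (A *v v + e))\<^sup>2"
  let ?d = "\<lambda>v. \<Sum>j\<in>I. 1 / 2 * (v $ j - z $ j)\<^sup>2
            + \<mu> * ((z $ j)\<^sup>2 * ln (z $ j / v $ j) + v $ j * z $ j - (z $ j)\<^sup>2)"
  have v: "v \<in> orthant I" using min by (simp add: is_arg_min_def)
  have le: "ereal (F v + c + ?q v) + ereal r * lqp \<mu> I v z
      \<le> ereal (F w + c + ?q w) + ereal r * lqp \<mu> I w z" if "w \<in> orthant I" for w
    using min that unfolding is_arg_min_linorder by blast
  \<comment> \<open>The previous iterate \<open>z\<close> is a competitor with finite value, whereas
    the objective is infinite off the positive orthant.\<close>
  show pos: "v \<in> pos_orthant I"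
  proof (rule ccontr)
    assume "v \<notin> pos_orthant I"
    then have "ereal (F v + c + ?q v) + ereal r * lqp \<mu> I v z = \<infinity>"
      using r by (simp add: lqp_def)
    moreover have "z \<in> orthant I" using z pos_orthant_subset by blast
    moreover have "ereal (F z + c + ?q z) + ereal r * lqp \<mu> I z z < \<infinity>"
      using z by (simp add: lqp_def)
    ultimately show False using le[of z] by (metis less_le_not_le)
  qed
  assume u: "u \<in> orthant I"
  have path: "A *v (v + t *\<^sub>R (u - v)) + e = (A *v v + e) + t *\<^sub>R (A *v (u - v))" for t
    by (simp add: matrix_vector_right_distrib matrix_vector_mult_scaleR)
  let ?H = "\<lambda>t. (- (l \<bullet> (A *v v + e + t *\<^sub>R (A *v (u - v))))
      + \<beta> / 2 * (norm (A *v v + e + t *\<^sub>R (A *v (u - v))))\<^sup>2) + r * ?d (v + t *\<^sub>R (u - v))"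
  have "(?H has_real_derivative (A *v (u - v)) \<bullet> (\<beta> *\<^sub>R (A *v v + e) - l)
          + r * (\<Sum>j\<in>I. (u - v) $ j * lqp_slope \<mu> (v $ j) (z $ j))) (at 0)"
    by (intro DERIV_add DERIV_cmult quadratic_path_derivative lqp_path_derivative pos z)
  \<comment> \<open>Inside the segment all coordinates in \<open>I\<close> stay positive even if
    \<open>u\<close> has zeros, so both values of \<open>lqp\<close> are finite and the
    \<open>ereal\<close> comparison becomes one between reals.\<close>
  moreover have "F v + ?H 0 \<le> F (v + t *\<^sub>R (u - v)) + ?H t" if t: "0 < t" "t < 1" for t
  proof -
    have P: "v + t *\<^sub>R (u - v) \<in> pos_orthant I" by (rule pos_orthant_segment[OF pos u t])
    then have "v + t *\<^sub>R (u - v) \<in> orthant I" using pos_orthant_subset by blast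
    from le[OF this] have "F v + ?q v + r * ?d v
        \<le> F (v + t *\<^sub>R (u - v)) + ?q (v + t *\<^sub>R (u - v)) + r * ?d (v + t *\<^sub>R (u - v))"
      using P pos by (simp add: lqp_def del: vector_add_component vector_scaleR_component)
    then show ?thesis unfolding path[symmetric] by simp
  qed
  ultimately have "0 \<le> F u - F v + ((A *v (u - v)) \<bullet> (\<beta> *\<^sub>R (A *v v + e) - l)
          + r * (\<Sum>j\<in>I. (u - v) $ j * lqp_slope \<mu> (v $ j) (z $ j)))"
    by (intro minimizer_on_segment[OF F v u])
  then show "0 \<le> F u - F v + (A *v (u - v)) \<bullet> (\<beta> *\<^sub>R (A *v v + e) - l)
          + r * (\<Sum>j\<in>I. (u $ j - v $ j) * lqp_slope \<mu> (v $ j) (z $ j))"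
    by simp
qed

section \<open>Quadratic forms behind the decrease\<close>

text \<open>The hypothesis on \<open>R\<close>, \<open>R'\<close> and \<delta> is what two
  consecutive y-steps provide. It trades \<langle>R, \<delta>\<rangle> for \<langle>\<delta>,
  R'\<rangle>, which Young's inequality splits into squares. The multiple of |R'|^2 must not exceed
  that of |R|^2, so that both telescope, while a positive multiple of |\<delta>|^2 has to
  survive.\<close>

lemma pairing_negative_definite:
  fixes \<alpha> \<tau> :: real
  assumes "(\<alpha>, \<tau>) \<in> stepsizes"
  obtains c\<^sub>1 c\<^sub>2 :: real where "0 \<le> c\<^sub>1" "0 < c\<^sub>2"
    "\<And>R R' \<delta> :: 'a::real_inner.
      (1 + \<alpha>) * (R \<bullet> \<delta>) \<le> (1 - \<tau>) * (\<delta> \<bullet> R') + \<alpha> * (norm \<delta>)\<^sup>2 \<Longrightarrow>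
      - (1 - (\<alpha> + \<tau>) / 2) * (norm R)\<^sup>2 + (1 - \<alpha>) * (R \<bullet> \<delta>) - (1 - \<alpha>) / 2 * (norm \<delta>)\<^sup>2
        \<le> c\<^sub>1 * (norm R')\<^sup>2 - c\<^sub>1 * (norm R)\<^sup>2 - c\<^sub>2 * (norm \<delta>)\<^sup>2"
proof -
  have \<alpha>: "- 1 < \<alpha>" "\<alpha> < 1" and K: "1 + \<alpha> + \<tau> - \<alpha> * \<tau> - \<alpha>\<^sup>2 - \<tau>\<^sup>2 > 0"
    using assms by (auto simp: stepsizes_def)
  define a where "a = 1 - (\<alpha> + \<tau>) / 2"
  define q where "q = (1 - \<tau>)\<^sup>2 / (2 * (1 + \<alpha>))"
  \<comment> \<open>The difference of the two sides is exactly the polynomial in the definition of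
    \<open>stepsizes\<close>.\<close>
  have "(1 - \<tau>)\<^sup>2 < a * (2 * (1 + \<alpha>))"
    using K by (simp add: a_def power2_eq_square field_simps)
  then have qa: "q < a" using \<alpha> by (simp add: q_def pos_divide_less_eq)
  have q0: "0 \<le> q" using \<alpha> by (simp add: q_def)
  then have a0: "0 < a" using qa by simp
  \<comment> \<open>\<open>s\<close> is the free weight in Young's inequality. At
    \<open>s = 1\<close> the |\<delta>|^2 terms would cancel exactly, and at
    \<open>s = q / a\<close> the coefficient of |R'|^2 would be exactly \<open>a\<close>. The
    midpoint leaves room on both sides, because \<open>q < a\<close>.\<close>
  define s where "s = (1 + q / a) / 2"
  have s: "q / a < s" "s < 1" using qa a0 by (auto simp: s_def field_simps)
  have s0: "0 < s" using q0 a0 s(1) by (smt (verit) divide_nonneg_pos)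
  have qs: "q / s \<le> a" using s s0 a0 by (simp add: field_simps)
  define c where "c = (1 - \<alpha>)\<^sup>2 * (1 - s) / (2 * (1 + \<alpha>))"
  show thesis
  proof
    show "0 \<le> a" using a0 by simp
    show "0 < c" using \<alpha> s by (simp add: c_def)
    fix R R' \<delta> :: 'a
    assume H: "(1 + \<alpha>) * (R \<bullet> \<delta>) \<le> (1 - \<tau>) * (\<delta> \<bullet> R') + \<alpha> * (norm \<delta>)\<^sup>2"
    have "0 \<le> (norm (((1 - \<alpha>) * s) *\<^sub>R \<delta> - (1 - \<tau>) *\<^sub>R R'))\<^sup>2" by simp
    also have "\<dots> = ((1 - \<alpha>) * s)\<^sup>2 * (norm \<delta>)\<^sup>2 - 2 * ((1 - \<alpha>) * s) * ((1 - \<tau>) * (\<delta> \<bullet> R'))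
        + (1 - \<tau>)\<^sup>2 * (norm R')\<^sup>2"
      unfolding power2_norm_eq_inner
      by (simp add: inner_diff_left inner_diff_right inner_commute[of R' \<delta>] power2_eq_square)
         (simp add: algebra_simps)
    finally have "(1 - \<tau>) * (\<delta> \<bullet> R')
        \<le> (((1 - \<alpha>) * s)\<^sup>2 * (norm \<delta>)\<^sup>2 + (1 - \<tau>)\<^sup>2 * (norm R')\<^sup>2) / (2 * ((1 - \<alpha>) * s))"
      using \<alpha> s0 by (subst pos_le_divide_eq) (auto simp: mult_ac)
    also have "\<dots> = (1 - \<alpha>) * s / 2 * (norm \<delta>)\<^sup>2 + (1 - \<tau>)\<^sup>2 / (2 * ((1 - \<alpha>) * s)) * (norm R')\<^sup>2"
      using \<alpha> s0 by (simp add: add_divide_distrib power2_eq_square)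
    finally have "R \<bullet> \<delta> \<le> ((1 - \<alpha>) * s / 2 * (norm \<delta>)\<^sup>2
        + (1 - \<tau>)\<^sup>2 / (2 * ((1 - \<alpha>) * s)) * (norm R')\<^sup>2 + \<alpha> * (norm \<delta>)\<^sup>2) / (1 + \<alpha>)"
      using H \<alpha> by (subst pos_le_divide_eq) (auto simp: mult_ac)
    then have "(1 - \<alpha>) * (R \<bullet> \<delta>) \<le> (1 - \<alpha>) * (((1 - \<alpha>) * s / 2 * (norm \<delta>)\<^sup>2
        + (1 - \<tau>)\<^sup>2 / (2 * ((1 - \<alpha>) * s)) * (norm R')\<^sup>2 + \<alpha> * (norm \<delta>)\<^sup>2) / (1 + \<alpha>))"
      using \<alpha> by (intro mult_left_mono) auto
    also have "\<dots> = q / s * (norm R')\<^sup>2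
        + ((1 - \<alpha>) * ((1 - \<alpha>) * s / 2 + \<alpha>) / (1 + \<alpha>)) * (norm \<delta>)\<^sup>2"
      using \<alpha> s0 by (simp add: q_def divide_simps) (simp add: algebra_simps)
    also have "(1 - \<alpha>) * ((1 - \<alpha>) * s / 2 + \<alpha>) / (1 + \<alpha>) = (1 - \<alpha>) / 2 - c"
      using \<alpha> by (simp add: c_def divide_simps) (simp add: algebra_simps power2_eq_square)
    finally have "(1 - \<alpha>) * (R \<bullet> \<delta>) \<le> q / s * (norm R')\<^sup>2 + ((1 - \<alpha>) / 2 - c) * (norm \<delta>)\<^sup>2" .
    moreover have "q / s * (norm R')\<^sup>2 \<le> a * (norm R')\<^sup>2"
      using qs by (intro mult_right_mono) auto
    ultimately show "- (1 - (\<alpha> + \<tau>) / 2) * (norm R)\<^sup>2 + (1 - \<alpha>) * (R \<bullet> \<delta>) - (1 - \<alpha>) / 2 * (norm \<delta>)\<^sup>2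
        \<le> a * (norm R')\<^sup>2 - a * (norm R)\<^sup>2 - c * (norm \<delta>)\<^sup>2"
      by (simp add: a_def[symmetric] left_diff_distrib)
  qed
qed

lemma norm_sum_squared_le:
  fixes v :: "'i \<Rightarrow> 'a::real_normed_vector"
  shows "(norm (\<Sum>i\<in>S. v i))\<^sup>2 \<le> real (card S) * (\<Sum>i\<in>S. (norm (v i))\<^sup>2)"
proof -
  have "(norm (\<Sum>i\<in>S. v i))\<^sup>2 \<le> (\<Sum>i\<in>S. norm (v i))\<^sup>2"
    by (intro power_mono norm_sum) auto
  also have "\<dots> \<le> (\<Sum>i\<in>S. (norm (v i))\<^sup>2) * real (card S)"
    by (cases "finite S") (auto intro: sum_squared_le_sum_of_squares)
  finally show ?thesis by (simp add: mult.commute)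
qed

lemma norm_matrix_vector_squared_le:
  fixes A :: "real^'m::finite^'n::finite"
  shows "(norm (A *v v))\<^sup>2 \<le> onorm ((*v) (transpose A ** A)) * (norm v)\<^sup>2"
proof -
  have "(norm (A *v v))\<^sup>2 = v \<bullet> ((transpose A ** A) *v v)"
    by (metis power2_norm_eq_inner matrix_vector_mul_assoc vector_transpose_matrix transpose_transpose
        dot_lmul_matrix)
  also have "\<dots> \<le> norm v * norm ((transpose A ** A) *v v)" by (rule norm_cauchy_schwarz)
  also have "\<dots> \<le> norm v * (onorm ((*v) (transpose A ** A)) * norm v)"
    by (intro mult_left_mono onorm matrix_vector_mul_bounded_linear) auto
  finally show ?thesis by (simp add: power2_eq_square mult_ac)
qed

text \<open>Updating all blocks in parallel leaves the negative square of the summed images, which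
  Cauchy-Schwarz bounds by \<open>p\<close> times the sum of the single squares. One of these
  \<open>p\<close> copies is paid by the positive \<beta>/2 term and the other p - 1 by the proximal
  weights, through the lower bound on \<open>r i\<close>. The leftover per block is
  \<open>m i\<close>.\<close>

lemma block_energy_coercive:
  fixes A :: "nat \<Rightarrow> real^'m::finite^'n::finite"
  assumes p: "1 \<le> p" and \<beta>: "0 < \<beta>" and \<mu>: "\<mu> < 1"
    and r: "\<And>i. i \<in> {1..p} \<Longrightarrow> 0 < r i"
    and \<gamma>: "(real p - 1) / (1 - \<mu>) < \<gamma>"
    and bound: "\<And>i. i \<in> {1..p} \<Longrightarrow> \<gamma> * \<beta> * onorm ((*v) (transpose (A i) ** A i)) \<le> r i"
  obtains c where "0 < c" "\<And>v. c * (\<Sum>i\<in>{1..p}. (norm (v i))\<^sup>2)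
      \<le> (\<Sum>i\<in>{1..p}. r i * (1 - \<mu>) / 2 * (norm (v i))\<^sup>2 + \<beta> / 2 * (norm (A i *v v i))\<^sup>2)
        - \<beta> / 2 * (norm (\<Sum>i\<in>{1..p}. A i *v v i))\<^sup>2"
proof -
  define N where "N i = onorm ((*v) (transpose (A i) ** A i))" for i
  define m where "m i = (r i * (1 - \<mu>) - (real p - 1) * \<beta> * N i) / 2" for i
  have N0: "0 \<le> N i" for i
    unfolding N_def by (intro onorm_pos_le matrix_vector_mul_bounded_linear)
  have m0: "0 < m i" if i: "i \<in> {1..p}" for i
  \<comment> \<open>For a vanishing norm the strict bound on \<gamma> yields only equality after
    multiplication, so strictness comes from \<open>r i > 0\<close>.\<close>
  proof (cases "N i = 0")
    case True
    then show ?thesis using r[OF i] \<mu> by (simp add: m_def)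
  next
    case False
    have "real p - 1 < \<gamma> * (1 - \<mu>)" using \<gamma> \<mu> by (simp add: pos_divide_less_eq)
    then have "(real p - 1) * (\<beta> * N i) < \<gamma> * (1 - \<mu>) * (\<beta> * N i)"
      using False N0[of i] \<beta> by (intro mult_strict_right_mono) auto
    also have "\<dots> \<le> r i * (1 - \<mu>)"
      using mult_right_mono[OF bound[OF i], of "1 - \<mu>"] \<mu> by (simp add: N_def mult_ac)
    finally show ?thesis by (simp add: m_def mult_ac)
  qed
  define c where "c = Min (m ` {1..p})"
  have ne: "m ` {1..p} \<noteq> {}" using p by simp
  show thesis
  proof
    show "0 < c" unfolding c_def using m0 ne by (subst Min_gr_iff) auto
    fix v :: "nat \<Rightarrow> real^'m"
    have "c * (\<Sum>i\<in>{1..p}. (norm (v i))\<^sup>2)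
        \<le> (\<Sum>i\<in>{1..p}. r i * (1 - \<mu>) / 2 * (norm (v i))\<^sup>2
              + (\<beta> / 2 - \<beta> / 2 * real p) * (norm (A i *v v i))\<^sup>2)"
      unfolding sum_distrib_left
    proof (intro sum_mono)
      fix i assume i: "i \<in> {1..p}"
      have "c \<le> m i" unfolding c_def using i by (intro Min_le) auto
      then have "c * (norm (v i))\<^sup>2 \<le> m i * (norm (v i))\<^sup>2" by (intro mult_right_mono) auto
      moreover have "\<beta> / 2 * (real p - 1) * (norm (A i *v v i))\<^sup>2
          \<le> \<beta> / 2 * (real p - 1) * (N i * (norm (v i))\<^sup>2)"
        using p \<beta> unfolding N_def by (intro mult_left_mono norm_matrix_vector_squared_le) auto
      ultimately show "c * (norm (v i))\<^sup>2 \<le> r i * (1 - \<mu>) / 2 * (norm (v i))\<^sup>2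
              + (\<beta> / 2 - \<beta> / 2 * real p) * (norm (A i *v v i))\<^sup>2"
        by (simp add: m_def field_simps)
    qed
    also have "\<dots> = (\<Sum>i\<in>{1..p}. r i * (1 - \<mu>) / 2 * (norm (v i))\<^sup>2 + \<beta> / 2 * (norm (A i *v v i))\<^sup>2)
        - \<beta> / 2 * (real p * (\<Sum>i\<in>{1..p}. (norm (A i *v v i))\<^sup>2))"
      by (simp add: sum.distrib sum_subtractf sum_distrib_left left_diff_distrib mult.assoc)
    also have "\<dots> \<le> (\<Sum>i\<in>{1..p}. r i * (1 - \<mu>) / 2 * (norm (v i))\<^sup>2 + \<beta> / 2 * (norm (A i *v v i))\<^sup>2)
        - \<beta> / 2 * (norm (\<Sum>i\<in>{1..p}. A i *v v i))\<^sup>2"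
      using norm_sum_squared_le[of "\<lambda>i. A i *v v i" "{1..p}"] \<beta> by (simp add: mult_left_mono)
    finally show "c * (\<Sum>i\<in>{1..p}. (norm (v i))\<^sup>2)
      \<le> (\<Sum>i\<in>{1..p}. r i * (1 - \<mu>) / 2 * (norm (v i))\<^sup>2 + \<beta> / 2 * (norm (A i *v v i))\<^sup>2)
        - \<beta> / 2 * (norm (\<Sum>i\<in>{1..p}. A i *v v i))\<^sup>2" .
  qed
qed

lemma inner_diff_polarization:
  fixes a a' :: "'a::real_inner"
  shows "a \<bullet> (a - a') = ((norm a)\<^sup>2 + (norm (a - a'))\<^sup>2 - (norm a')\<^sup>2) / 2"
  unfolding power2_norm_eq_inner
  by (simp add: inner_diff_left inner_diff_right inner_commute[of a' a])

text \<open>For the application, \<open>E\<close> and \<eta> are the images under A and B of the new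
  errors, \<open>\<eta>'\<close> is the old image under B, and \<Lambda> is the multiplier error.
  The left side gathers what the optimality conditions leave; its dependence on \<Lambda> is just
  \<langle>R, \<Lambda>\<rangle>. Replacing \<Lambda> by \<open>M\<close> absorbs this into a
  difference of squares, since \<open>M\<close> moves by a multiple of \<open>R\<close>
  alone.\<close>

lemma multiplier_energy_identity:
  fixes E \<eta> \<eta>' \<Lambda> :: "'a::real_inner"
  assumes \<kappa>: "\<alpha> + \<tau> \<noteq> 0" and \<beta>: "\<beta> \<noteq> 0"
  defines "R \<equiv> E + \<eta>"
  defines "s \<equiv> E + \<eta>'"
  defines "\<Lambda>\<^sub>1 \<equiv> \<Lambda> - (\<alpha> * \<beta>) *\<^sub>R s - (\<tau> * \<beta>) *\<^sub>R R"
  shows "- (E \<bullet> (\<beta> *\<^sub>R s - \<Lambda>)) - \<eta> \<bullet> ((\<alpha> * \<beta>) *\<^sub>R s + \<beta> *\<^sub>R R - \<Lambda>)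
    = ((norm (\<Lambda> - (\<alpha> * \<beta>) *\<^sub>R \<eta>'))\<^sup>2 - (norm (\<Lambda>\<^sub>1 - (\<alpha> * \<beta>) *\<^sub>R \<eta>))\<^sup>2) / (2 * (\<alpha> + \<tau>) * \<beta>)
      + (1 - \<alpha>) * \<beta> / 2 * ((norm \<eta>')\<^sup>2 - (norm \<eta>)\<^sup>2)
      + \<beta> * (- (1 - (\<alpha> + \<tau>) / 2) * (norm R)\<^sup>2 + (1 - \<alpha>) * (R \<bullet> (\<eta> - \<eta>'))
             - (1 - \<alpha>) / 2 * (norm (\<eta> - \<eta>'))\<^sup>2)"
proof -
  define M where "M = \<Lambda> - (\<alpha> * \<beta>) *\<^sub>R \<eta>'"
  have "\<Lambda>\<^sub>1 - (\<alpha> * \<beta>) *\<^sub>R \<eta> = M - ((\<alpha> + \<tau>) * \<beta>) *\<^sub>R R"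
    by (simp add: \<Lambda>\<^sub>1_def M_def s_def R_def algebra_simps)
  then have "(norm M)\<^sup>2 - (norm (\<Lambda>\<^sub>1 - (\<alpha> * \<beta>) *\<^sub>R \<eta>))\<^sup>2
      = 2 * (\<alpha> + \<tau>) * \<beta> * (R \<bullet> M - (\<alpha> + \<tau>) * \<beta> / 2 * (norm R)\<^sup>2)"
    unfolding power2_norm_eq_inner
    by (simp add: inner_diff_left inner_diff_right inner_commute[of M R]) (simp add: field_simps)
  then have eq: "((norm M)\<^sup>2 - (norm (\<Lambda>\<^sub>1 - (\<alpha> * \<beta>) *\<^sub>R \<eta>))\<^sup>2) / (2 * (\<alpha> + \<tau>) * \<beta>)
      = R \<bullet> M - (\<alpha> + \<tau>) * \<beta> / 2 * (norm R)\<^sup>2"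
    using \<kappa> \<beta> by simp
  show ?thesis
    unfolding M_def[symmetric] eq
    unfolding power2_norm_eq_inner M_def R_def s_def
    by (simp add: inner_add_left inner_add_right inner_diff_left inner_diff_right
        inner_commute[of \<eta> E] inner_commute[of \<eta>' E] inner_commute[of \<eta>' \<eta>])
       (simp add: field_simps)
qed

text \<open>Brings the x-subproblem into the shape expected by \<open>lqp_minimizer\<close>:
  subtracting the contribution of block \<open>i\<close> from the residual leaves its constant
  part.\<close>

lemma aug_lagrangian_block:
  assumes i: "i \<in> {1..p}"
  shows "aug_lagrangian p A B b f g \<beta> (x(i := v)) y l
    = f i v + ((\<Sum>j\<in>{1..p} - {i}. f j (x j)) + g y)
      + (- (l \<bullet> (A i *v v + (residual p A B b x y - A i *v x i)))
         + \<beta> / 2 * (norm (A i *v v + (residual p A B b x y - A i *v x i)))\<^sup>2)"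
proof -
  have "(\<Sum>j\<in>{1..p}. A j *v (x(i := v)) j) = A i *v v + (\<Sum>j\<in>{1..p} - {i}. A j *v x j)"
    "(\<Sum>j\<in>{1..p}. A j *v x j) = A i *v x i + (\<Sum>j\<in>{1..p} - {i}. A j *v x j)"
    "(\<Sum>j\<in>{1..p}. f j ((x(i := v)) j)) = f i v + (\<Sum>j\<in>{1..p} - {i}. f j (x j))"
    using i by (simp_all add: sum.remove[of _ i])
  then show ?thesis
    by (simp add: aug_lagrangian_def objective_def residual_def add.assoc add_diff_eq[symmetric])
qed

text \<open>\<open>y\<close> is a free reference point whose contribution cancels. Taking it to be
  the minimizer itself makes the residual after the full iteration appear in
  \<open>y_step_VI\<close>.\<close>

lemma aug_lagrangian_last_block:
  "aug_lagrangian p A B b f g \<beta> x v l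
    = g v + (\<Sum>j\<in>{1..p}. f j (x j))
      + (- (l \<bullet> (B *v v + (residual p A B b x y - B *v y)))
         + \<beta> / 2 * (norm (B *v v + (residual p A B b x y - B *v y)))\<^sup>2)"
  by (simp add: aug_lagrangian_def objective_def residual_def algebra_simps)

section \<open>Runs of the algorithm and their variational inequalities\<close>

text \<open>One saddle point is fixed for the whole argument, but no run is: the lemmas quantify
  over runs, because two runs have to be compared and the constants must not depend on them.\<close>

locale admm_lqp_setting =
  fixes p :: nat
    and I :: "nat \<Rightarrow> 'm::finite set"
    and A :: "nat \<Rightarrow> real^'m^'n::finite"
    and B :: "real^'d::finite^'n"
    and b :: "real^'n"
    and f :: "nat \<Rightarrow> real^'m \<Rightarrow> real"
    and g :: "real^'d \<Rightarrow> real"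
    and Y :: "(real^'d) set"
    and \<beta> \<mu> \<alpha> \<tau> :: real
    and r :: "nat \<Rightarrow> real"
    and \<gamma> :: real and xs :: "nat \<Rightarrow> real^'m" and ys :: "real^'d" and ls :: "real^'n"
  assumes f_convex: "\<And>i. i \<in> {1..p} \<Longrightarrow> convex_on (orthant (I i)) (f i)"
    and g_convex: "convex_on Y g"
    and \<beta>_pos: "0 < \<beta>"
    and \<mu>_pos: "0 < \<mu>"
    and stepsizes: "(\<alpha>, \<tau>) \<in> stepsizes"
    and r_pos: "\<And>i. i \<in> {1..p} \<Longrightarrow> 0 < r i"
    and inj_B: "inj ((*v) B)"
    and p_pos: "1 \<le> p" and \<mu>_less: "\<mu> < 1"
    and \<gamma>: "(real p - 1) / (1 - \<mu>) < \<gamma>"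
    and r_bound: "\<And>i. i \<in> {1..p} \<Longrightarrow> \<gamma> * \<beta> * onorm ((*v) (transpose (A i) ** A i)) \<le> r i"
    and saddle: "(xs, ys, ls) \<in> VI_solutions p I A B b f g Y"
begin

abbreviation run where
  "run x y l \<equiv> (\<forall>i\<in>{1..p}. x 0 i \<in> pos_orthant (I i)) \<and>
     admm_lqp p I A B b f g Y \<beta> \<mu> r \<alpha> \<tau> (x 0) (y 0) (l 0) x y l"

abbreviation res where "res \<equiv> residual p A B b"

abbreviation half_multiplier where
  "half_multiplier x y l k \<equiv> l k - (\<alpha> * \<beta>) *\<^sub>R res (x (Suc k)) (y k)"

lemma x_step_argmin:
  assumes "run x y l" "i \<in> {1..p}"
  shows "is_arg_min
      (\<lambda>v. ereal (f i v + ((\<Sum>j\<in>{1..p} - {i}. f j (x k j)) + g (y k))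
        + (- (l k \<bullet> (A i *v v + (res (x k) (y k) - A i *v x k i)))
            + \<beta> / 2 * (norm (A i *v v + (res (x k) (y k) - A i *v x k i)))\<^sup>2))
        + ereal (r i) * lqp \<mu> (I i) v (x k i)) (\<lambda>v. v \<in> orthant (I i)) (x (Suc k) i)"
  using assms unfolding admm_lqp_def by (simp add: aug_lagrangian_block)

lemma x_pos:
  assumes "run x y l" "i \<in> {1..p}"
  shows "x k i \<in> pos_orthant (I i)"
proof (induction k)
  case 0
  show ?case using assms by blast
next
  case (Suc k)
  show ?case
    by (rule lqp_minimizer_pos[OF f_convex[OF assms(2)] r_pos[OF assms(2)] Suc.IH x_step_argmin[OF assms]])
qed

lemma x_step_VI:
  assumes "run x y l" "i \<in> {1..p}" "u \<in> orthant (I i)"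
  shows "0 \<le> f i u - f i (x (Suc k) i)
    + (A i *v (u - x (Suc k) i)) \<bullet>
        (\<beta> *\<^sub>R (A i *v x (Suc k) i + (res (x k) (y k) - A i *v x k i)) - l k)
    + r i * (\<Sum>j\<in>I i. (u $ j - x (Suc k) i $ j) * lqp_slope \<mu> (x (Suc k) i $ j) (x k i $ j))"
  by (rule lqp_minimizer_VI[OF f_convex[OF assms(2)] r_pos[OF assms(2)] x_pos[OF assms(1,2)]
        x_step_argmin[OF assms(1,2)] assms(3)])

lemma y_step_argmin:
  assumes "run x y l"
  shows "is_arg_min
      (\<lambda>v. g v + (\<Sum>j\<in>{1..p}. f j (x (Suc k) j))
        + (- (half_multiplier x y l k \<bullet> (B *v v + (res (x (Suc k)) (y (Suc k)) - B *v y (Suc k))))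
           + \<beta> / 2 * (norm (B *v v + (res (x (Suc k)) (y (Suc k)) - B *v y (Suc k))))\<^sup>2))
      (\<lambda>v. v \<in> Y) (y (Suc k))"
  using assms unfolding admm_lqp_def
  by (simp add: Let_def aug_lagrangian_last_block[where y = "y (Suc k)"])

lemma y_in_Y:
  assumes "run x y l"
  shows "y (Suc k) \<in> Y"
  using y_step_argmin[OF assms] by (simp add: is_arg_min_def)

lemma l_step:
  assumes "run x y l"
  shows "l (Suc k) = half_multiplier x y l k - (\<tau> * \<beta>) *\<^sub>R res (x (Suc k)) (y (Suc k))"
  using assms unfolding admm_lqp_def by (simp add: Let_def)

lemma y_step_VI:
  assumes "run x y l" "u \<in> Y"
  shows "0 \<le> g u - g (y (Suc k))
    + (B *v (u - y (Suc k))) \<bullet> (\<beta> *\<^sub>R res (x (Suc k)) (y (Suc k)) - half_multiplier x y l k)"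
  using quadratic_minimizer_VI[OF g_convex
      y_step_argmin[OF assms(1)] assms(2)]
  by simp

section \<open>Uniqueness of the first iteration\<close>

lemma residual_cong:
  assumes "\<And>i. i \<in> {1..p} \<Longrightarrow> x i = x' i"
  shows "res x y = res x' y"
  using assms by (simp add: residual_def)

text \<open>Each of the two variational inequalities is tested with the other minimizer. In the sum
  the values of \<open>f i\<close> cancel and the quadratic terms are nonpositive, so strong
  monotonicity of the slope forces equality. This is needed since \<open>is_arg_min\<close> by
  itself allows several runs from one starting point.\<close>

lemma first_x_step_unique:
  assumes run: "run x y l" and run': "run x' y' l'"
    and start: "\<And>i. i \<in> {1..p} \<Longrightarrow> x 0 i = x' 0 i" "y 0 = y' 0" "l 0 = l' 0"
    and i: "i \<in> {1..p}"
  shows "x 1 i = x' 1 i"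
proof -
  let ?v = "x 1 i" and ?v' = "x' 1 i" and ?z = "x' 0 i"
  let ?e = "res (x' 0) (y' 0) - A i *v ?z"
  have pos: "?v \<in> pos_orthant (I i)" "?v' \<in> pos_orthant (I i)"
    using x_pos run run' i by blast+
  then have orth: "?v \<in> orthant (I i)" "?v' \<in> orthant (I i)"
    using pos_orthant_subset by blast+
  have "0 \<le> f i ?v' - f i ?v + (A i *v (?v' - ?v)) \<bullet> (\<beta> *\<^sub>R (A i *v ?v + ?e) - l' 0)
    + r i * (\<Sum>j\<in>I i. (?v' $ j - ?v $ j) * lqp_slope \<mu> (?v $ j) (?z $ j))"
    using x_step_VI[OF run i orth(2), of 0] start i residual_cong[of "x 0" "x' 0"] by simp
  moreover have "0 \<le> f i ?v - f i ?v' + (A i *v (?v - ?v')) \<bullet> (\<beta> *\<^sub>R (A i *v ?v' + ?e) - l' 0)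
    + r i * (\<Sum>j\<in>I i. (?v $ j - ?v' $ j) * lqp_slope \<mu> (?v' $ j) (?z $ j))"
    using x_step_VI[OF run' i orth(1), of 0] by simp
  moreover have "(A i *v (?v' - ?v)) \<bullet> (\<beta> *\<^sub>R (A i *v ?v + ?e) - l' 0)
      + (A i *v (?v - ?v')) \<bullet> (\<beta> *\<^sub>R (A i *v ?v' + ?e) - l' 0)
      = - \<beta> * (norm (A i *v (?v' - ?v)))\<^sup>2"
    unfolding power2_norm_eq_inner
    by (simp add: matrix_vector_mult_diff_distrib inner_diff_left inner_diff_right inner_add_left
        inner_add_right inner_commute[of "A i *v ?v'" "A i *v ?v"]) (simp add: algebra_simps)
  moreover have "0 \<le> \<beta> * (norm (A i *v (?v' - ?v)))\<^sup>2" using \<beta>_pos by simp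
  ultimately have "0 \<le> r i * ((\<Sum>j\<in>I i. (?v' $ j - ?v $ j) * lqp_slope \<mu> (?v $ j) (?z $ j))
      + (\<Sum>j\<in>I i. (?v $ j - ?v' $ j) * lqp_slope \<mu> (?v' $ j) (?z $ j)))"
    unfolding distrib_left by linarith
  then have "(\<Sum>j\<in>I i. (?v $ j - ?v' $ j) * (lqp_slope \<mu> (?v $ j) (?z $ j) - lqp_slope \<mu> (?v' $ j) (?z $ j))) \<le> 0"
    using r_pos[OF i]
    by (simp add: zero_le_mult_iff sum.distrib[symmetric] right_diff_distrib left_diff_distrib
        sum_subtractf)
  moreover have "(\<Sum>j\<in>I i. (?v $ j - ?v' $ j)\<^sup>2)
      \<le> (\<Sum>j\<in>I i. (?v $ j - ?v' $ j) * (lqp_slope \<mu> (?v $ j) (?z $ j) - lqp_slope \<mu> (?v' $ j) (?z $ j)))"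
    using pos by (intro sum_mono lqp_slope_monotone \<mu>_pos) (auto simp: pos_orthant_def)
  ultimately have "(\<Sum>j\<in>I i. (?v $ j - ?v' $ j)\<^sup>2) \<le> 0" by linarith
  then have "(\<Sum>j\<in>I i. (?v $ j - ?v' $ j)\<^sup>2) = 0"
    by (intro antisym sum_nonneg) auto
  then have "?v $ j = ?v' $ j" if "j \<in> I i" for j
    using that by (simp add: sum_nonneg_eq_0_iff)
  moreover have "?v $ j = ?v' $ j" if "j \<notin> I i" for j
    using that pos by (simp add: pos_orthant_def)
  ultimately show ?thesis by (metis vec_eq_iff)
qed

text \<open>Cross-testing works as for the blocks, except that strict convexity now comes from the
  penalty, through injectivity of B.\<close>

lemma first_step_unique:
  assumes run: "run x y l" and run': "run x' y' l'"
    and start: "\<And>i. i \<in> {1..p} \<Longrightarrow> x 0 i = x' 0 i" "y 0 = y' 0" "l 0 = l' 0"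
  shows "y 1 = y' 1" "l 1 = l' 1"
proof -
  have x: "res (x 1) = res (x' 1)"
    by (rule ext, rule residual_cong) (use first_x_step_unique[OF assms] in blast)
  have h: "half_multiplier x y l 0 = half_multiplier x' y' l' 0"
    using x start by simp
  have "0 \<le> g (y' 1) - g (y 1)
    + (B *v (y' 1 - y 1)) \<bullet> (\<beta> *\<^sub>R res (x' 1) (y 1) - half_multiplier x' y' l' 0)"
    using y_step_VI[OF run y_in_Y[OF run'], of 0 0] x h by simp
  moreover have "0 \<le> g (y 1) - g (y' 1)
    + (B *v (y 1 - y' 1)) \<bullet> (\<beta> *\<^sub>R res (x' 1) (y' 1) - half_multiplier x' y' l' 0)"
    using y_step_VI[OF run' y_in_Y[OF run], of 0 0] by simp
  moreover have "(B *v (y' 1 - y 1)) \<bullet> (\<beta> *\<^sub>R res (x' 1) (y 1) - h)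
      + (B *v (y 1 - y' 1)) \<bullet> (\<beta> *\<^sub>R res (x' 1) (y' 1) - h)
      = - \<beta> * (norm (B *v (y' 1 - y 1)))\<^sup>2" for h
    unfolding power2_norm_eq_inner residual_def
    by (simp add: matrix_vector_mult_diff_distrib inner_diff_left inner_diff_right inner_add_left
        inner_add_right inner_commute[of "B *v y' 1" "B *v y 1"]) (simp add: algebra_simps)
  from this[of "half_multiplier x' y' l' 0"] have "\<beta> * (norm (B *v (y' 1 - y 1)))\<^sup>2 \<le> 0"
    using calculation by linarith
  then have "B *v (y' 1 - y 1) = 0"
    using \<beta>_pos by (simp add: mult_le_0_iff)
  then have "B *v y' 1 = B *v y 1" by (simp add: matrix_vector_mult_diff_distrib)
  then show y: "y 1 = y' 1" using injD[OF inj_B] by metis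
  show "l 1 = l' 1"
    using l_step[OF run, of 0] l_step[OF run', of 0] x h y by simp
qed


section \<open>The saddle point and the energy\<close>

lemma xs_orthant: "i \<in> {1..p} \<Longrightarrow> xs i \<in> orthant (I i)"
  and ys_in_Y: "ys \<in> Y"
  using saddle by (auto simp: VI_solutions_def)

text \<open>The multiplier component is unconstrained, so it may be moved by minus the residual
  itself, which turns the inequality into -|res|^2 >= 0.\<close>

lemma saddle_residual: "res xs ys = 0"
proof -
  have "0 \<le> objective p f g xs ys - objective p f g xs ys
      + ((\<Sum>i\<in>{1..p}. (xs i - xs i) \<bullet> - (transpose (A i) *v ls))
         + (ys - ys) \<bullet> - (transpose B *v ls) + (ls - res xs ys - ls) \<bullet> res xs ys)"
    using saddle unfolding VI_solutions_def by blast
  then have "res xs ys \<bullet> res xs ys \<le> 0" by simp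
  then show ?thesis by (metis inner_ge_zero inner_eq_zero_iff antisym)
qed

lemma saddle_VI:
  assumes "\<And>i. i \<in> {1..p} \<Longrightarrow> u i \<in> orthant (I i)" "v \<in> Y"
  shows "0 \<le> objective p f g u v - objective p f g xs ys
    - (\<Sum>i\<in>{1..p}. A i *v (u i - xs i)) \<bullet> ls - (B *v (v - ys)) \<bullet> ls"
proof -
  have tr: "w \<bullet> - (transpose M *v ls) = - ((M *v w) \<bullet> ls)" for M :: "real^'k::finite^'n" and w
    by (metis inner_minus_right inner_commute dot_lmul_matrix vector_transpose_matrix transpose_transpose)
  have "0 \<le> objective p f g u v - objective p f g xs ys
      + ((\<Sum>i\<in>{1..p}. (u i - xs i) \<bullet> - (transpose (A i) *v ls))
         + (v - ys) \<bullet> - (transpose B *v ls) + (ls - ls) \<bullet> res xs ys)"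
    using saddle assms unfolding VI_solutions_def by blast
  then show ?thesis
    unfolding tr by (simp add: sum_negf inner_sum_left)
qed

text \<open>The weight \<open>\<nu>\<close> is a parameter because the form occurs twice: with 1 +
  \<mu> it measures the distance to the saddle point, with 1 - \<mu> the gain from one x-step. These
  are the two coefficients in \<open>lqp_slope_three_point\<close>.\<close>

definition block_energy where
  "block_energy \<nu> v = (\<Sum>i\<in>{1..p}. r i * \<nu> / 2 * (norm (v i))\<^sup>2 + \<beta> / 2 * (norm (A i *v v i))\<^sup>2)
    - \<beta> / 2 * (norm (\<Sum>i\<in>{1..p}. A i *v v i))\<^sup>2"

definition energy where
  "energy x y l = block_energy (1 + \<mu>) (\<lambda>i. x i - xs i)
    + (norm (l - ls - (\<alpha> * \<beta>) *\<^sub>R (B *v (y - ys))))\<^sup>2 / (2 * (\<alpha> + \<tau>) * \<beta>)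
    + (1 - \<alpha>) * \<beta> / 2 * (norm (B *v (y - ys)))\<^sup>2"

lemma block_energy_coerciveE:
  obtains c where "0 < c" "\<And>v. c * (\<Sum>i\<in>{1..p}. (norm (v i))\<^sup>2) \<le> block_energy (1 - \<mu>) v"
  by (rule block_energy_coercive[OF p_pos \<beta>_pos \<mu>_less r_pos \<gamma> r_bound])
     (auto simp only: block_energy_def)

text \<open>Coercivity is known for the weight 1 - \<mu>, and raising the weight to 1 + \<mu> only
  enlarges the form.\<close>

lemma energy_nonneg: "0 \<le> energy x y l"
proof -
  obtain c where c: "0 < c" "\<And>v. c * (\<Sum>i\<in>{1..p}. (norm (v i))\<^sup>2) \<le> block_energy (1 - \<mu>) v"
    by (rule block_energy_coerciveE) blast
  have "0 \<le> c * (\<Sum>i\<in>{1..p}. (norm (x i - xs i))\<^sup>2)"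
    using c(1) by (intro mult_nonneg_nonneg sum_nonneg) auto
  also have "\<dots> \<le> block_energy (1 - \<mu>) (\<lambda>i. x i - xs i)" by (rule c(2))
  also have "\<dots> \<le> block_energy (1 + \<mu>) (\<lambda>i. x i - xs i)"
    unfolding block_energy_def using \<mu>_pos r_pos
    by (intro diff_right_mono sum_mono add_right_mono mult_right_mono) (auto simp: less_imp_le)
  finally show ?thesis
    unfolding energy_def using stepsizes \<beta>_pos
    by (intro add_nonneg_nonneg) (auto simp: stepsizes_def)
qed

lemma x_step_estimate:
  assumes run: "run x y l" and i: "i \<in> {1..p}"
  shows "r i * ((1 + \<mu>) / 2 * ((norm (x (Suc k) i - xs i))\<^sup>2 - (norm (x k i - xs i))\<^sup>2)
           + (1 - \<mu>) / 2 * (norm (x (Suc k) i - x k i))\<^sup>2)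
    \<le> f i (xs i) - f i (x (Suc k) i)
      - (A i *v (x (Suc k) i - xs i)) \<bullet> (\<beta> *\<^sub>R (res (x k) (y k) + A i *v (x (Suc k) i - x k i)) - l k)"
proof -
  let ?v = "x (Suc k) i" and ?z = "x k i" and ?u = "xs i"
  have v: "?v \<in> pos_orthant (I i)" and z: "?z \<in> pos_orthant (I i)"
    using x_pos[OF run i] by blast+
  have u: "?u \<in> orthant (I i)" by (rule xs_orthant[OF i])
  \<comment> \<open>Both vectors vanish outside \<open>I i\<close>, so the full Euclidean norm
    reduces to the coordinates on which \<open>lqp\<close> acts.\<close>
  have supp: "(norm (w - w'))\<^sup>2 = (\<Sum>j\<in>I i. (w $ j - w' $ j)\<^sup>2)"
    if "w \<in> orthant (I i)" "w' \<in> orthant (I i)" for w w'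
  proof -
    have "(norm (w - w'))\<^sup>2 = (\<Sum>j\<in>UNIV. (w $ j - w' $ j)\<^sup>2)"
      unfolding power2_norm_eq_inner by (simp add: inner_vec_def power2_eq_square)
    also have "\<dots> = (\<Sum>j\<in>I i. (w $ j - w' $ j)\<^sup>2)"
      using that by (intro sum.mono_neutral_right) (auto simp: orthant_def)
    finally show ?thesis .
  qed
  have vz: "?v \<in> orthant (I i)" "?z \<in> orthant (I i)" using v z pos_orthant_subset by blast+
  have "(1 + \<mu>) / 2 * ((norm (?v - ?u))\<^sup>2 - (norm (?z - ?u))\<^sup>2) + (1 - \<mu>) / 2 * (norm (?v - ?z))\<^sup>2
      = (\<Sum>j\<in>I i. (1 + \<mu>) / 2 * ((?v $ j - ?u $ j)\<^sup>2 - (?z $ j - ?u $ j)\<^sup>2)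
          + (1 - \<mu>) / 2 * (?v $ j - ?z $ j)\<^sup>2)"
    unfolding supp[OF vz(1) u] supp[OF vz(2) u] supp[OF vz] sum.distrib sum_distrib_left[symmetric]
      sum_subtractf ..
  also have "\<dots> \<le> (\<Sum>j\<in>I i. (?v $ j - ?u $ j) * lqp_slope \<mu> (?v $ j) (?z $ j))"
    using v u by (intro sum_mono lqp_slope_three_point \<mu>_pos) (auto simp: pos_orthant_def orthant_def)
  also have "\<dots> = - (\<Sum>j\<in>I i. (?u $ j - ?v $ j) * lqp_slope \<mu> (?v $ j) (?z $ j))"
    unfolding sum_negf[symmetric] by (intro sum.cong) (auto simp: algebra_simps)
  finally have "r i * ((1 + \<mu>) / 2 * ((norm (?v - ?u))\<^sup>2 - (norm (?z - ?u))\<^sup>2) + (1 - \<mu>) / 2 * (norm (?v - ?z))\<^sup>2)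
      \<le> r i * - (\<Sum>j\<in>I i. (?u $ j - ?v $ j) * lqp_slope \<mu> (?v $ j) (?z $ j))"
    using r_pos[OF i] by (intro mult_left_mono) auto
  also have "\<dots> \<le> f i ?u - f i ?v
      - (A i *v (?v - ?u)) \<bullet> (\<beta> *\<^sub>R (res (x k) (y k) + A i *v (?v - ?z)) - l k)"
  proof -
    have neg: "A i *v (?u - ?v) = - (A i *v (?v - ?u))"
      and shift: "A i *v ?v + (res (x k) (y k) - A i *v ?z) = res (x k) (y k) + A i *v (?v - ?z)"
      by (simp_all add: matrix_vector_mult_diff_distrib)
    show ?thesis
      using x_step_VI[OF run i u, of k] unfolding neg shift inner_minus_left mult_minus_right by linarith
  qed
  finally show ?thesis .
qed

text \<open>The estimates for all blocks, the y-step tested at the saddle point and the saddle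
  inequality tested at the new iterate are added. All objective values cancel; polarization and
  \<open>multiplier_energy_identity\<close> turn the remaining pairings into energy
  differences.\<close>

lemma energy_step:
  assumes run: "run x y l"
  defines "R \<equiv> \<lambda>k. res (x k) (y k)" and "\<delta> \<equiv> \<lambda>k. B *v (y (Suc k) - y k)"
  shows "energy (x (Suc k)) (y (Suc k)) (l (Suc k)) + block_energy (1 - \<mu>) (\<lambda>i. x (Suc k) i - x k i)
    \<le> energy (x k) (y k) (l k)
      + \<beta> * (- (1 - (\<alpha> + \<tau>) / 2) * (norm (R (Suc k)))\<^sup>2 + (1 - \<alpha>) * (R (Suc k) \<bullet> \<delta> k)
             - (1 - \<alpha>) / 2 * (norm (\<delta> k))\<^sup>2)"
proof -
  define e where "e = (\<lambda>k i. A i *v (x k i - xs i))"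
  define E where "E = (\<lambda>k. \<Sum>i\<in>{1..p}. e k i)"
  define \<eta> where "\<eta> = (\<lambda>k. B *v (y k - ys))"
  define \<Lambda> where "\<Lambda> = l k - ls"
  \<comment> \<open>The residual between the x-step and the y-step, which drives the half-step
    multiplier.\<close>
  define s where "s = E (Suc k) + \<eta> k"
  define Q where "Q = (\<lambda>\<nu> k. \<Sum>i\<in>{1..p}. r i * \<nu> / 2 * (norm (x k i - xs i))\<^sup>2)"
  have res: "res (x j) (y k) = E j + \<eta> k" for j k
  proof -
    have "res (x j) (y k) = res (x j) (y k) - res xs ys" by (simp add: saddle_residual)
    also have "\<dots> = E j + \<eta> k"
      by (simp add: residual_def E_def e_def \<eta>_def matrix_vector_mult_diff_distrib sum_subtractf)
    finally show ?thesis .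
  qed
  have \<delta>: "\<delta> k = \<eta> (Suc k) - \<eta> k"
    by (simp add: \<delta>_def \<eta>_def matrix_vector_mult_diff_distrib)
  have De: "A i *v (x (Suc k) i - x k i) = e (Suc k) i - e k i" for i
    by (simp add: e_def matrix_vector_mult_diff_distrib)
  have \<eta>: "B *v (y j - ys) = \<eta> j" for j by (simp add: \<eta>_def)
  have DE: "(\<Sum>i\<in>{1..p}. A i *v (x (Suc k) i - x k i)) = E (Suc k) - E k"
    by (simp add: De E_def sum_subtractf)
  have "(\<Sum>i\<in>{1..p}. r i * ((1 + \<mu>) / 2 * ((norm (x (Suc k) i - xs i))\<^sup>2 - (norm (x k i - xs i))\<^sup>2)
           + (1 - \<mu>) / 2 * (norm (x (Suc k) i - x k i))\<^sup>2))
      \<le> (\<Sum>i\<in>{1..p}. f i (xs i) - f i (x (Suc k) i)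
           - e (Suc k) i \<bullet> (\<beta> *\<^sub>R (R k + (e (Suc k) i - e k i)) - l k))"
    using x_step_estimate[OF run] unfolding R_def De[symmetric] by (intro sum_mono) (simp add: e_def)
  also have "\<dots> = (\<Sum>i\<in>{1..p}. f i (xs i)) - (\<Sum>i\<in>{1..p}. f i (x (Suc k) i))
      - E (Suc k) \<bullet> (\<beta> *\<^sub>R R k - l k) - \<beta> * (\<Sum>i\<in>{1..p}. e (Suc k) i \<bullet> (e (Suc k) i - e k i))"
    by (simp add: sum_subtractf sum.distrib E_def inner_sum_left sum_distrib_left inner_diff_right
        inner_add_right scaleR_add_right algebra_simps del: scaleR_scaleR)
  finally have X: "(\<Sum>i\<in>{1..p}. r i * ((1 + \<mu>) / 2 * ((norm (x (Suc k) i - xs i))\<^sup>2 - (norm (x k i - xs i))\<^sup>2)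
           + (1 - \<mu>) / 2 * (norm (x (Suc k) i - x k i))\<^sup>2))
      \<le> (\<Sum>i\<in>{1..p}. f i (xs i)) - (\<Sum>i\<in>{1..p}. f i (x (Suc k) i))
      - E (Suc k) \<bullet> (\<beta> *\<^sub>R R k - l k) - \<beta> * (\<Sum>i\<in>{1..p}. e (Suc k) i \<bullet> (e (Suc k) i - e k i))" .
  have Bneg: "B *v (ys - y (Suc k)) = - \<eta> (Suc k)"
    by (simp add: \<eta>_def matrix_vector_mult_diff_distrib)
  have Yst: "0 \<le> g ys - g (y (Suc k))
      - \<eta> (Suc k) \<bullet> (\<beta> *\<^sub>R R (Suc k) - (l k - (\<alpha> * \<beta>) *\<^sub>R s))"
    using y_step_VI[OF run ys_in_Y, of k] unfolding Bneg by (simp add: R_def res s_def)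
  have VI: "0 \<le> objective p f g (x (Suc k)) (y (Suc k)) - objective p f g xs ys
      - E (Suc k) \<bullet> ls - \<eta> (Suc k) \<bullet> ls"
    using saddle_VI[of "x (Suc k)" "y (Suc k)"] y_in_Y[OF run] x_pos[OF run] pos_orthant_subset
    unfolding E_def e_def \<eta>_def by blast
  \<comment> \<open>The blocks are updated with the old residual rather than with \<open>s\<close>.
    After polarization this discrepancy produces the negative square in
    \<open>block_energy\<close>.\<close>
  have Rk: "R k = s - (E (Suc k) - E k)" by (simp add: R_def res s_def)
  have rhs: "- (E (Suc k) \<bullet> (\<beta> *\<^sub>R R k - l k)) - \<eta> (Suc k) \<bullet> (\<beta> *\<^sub>R R (Suc k) - (l k - (\<alpha> * \<beta>) *\<^sub>R s))
        - E (Suc k) \<bullet> ls - \<eta> (Suc k) \<bullet> ls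
      = - (E (Suc k) \<bullet> (\<beta> *\<^sub>R s - \<Lambda>)) - \<eta> (Suc k) \<bullet> ((\<alpha> * \<beta>) *\<^sub>R s + \<beta> *\<^sub>R R (Suc k) - \<Lambda>)
        + \<beta> * (E (Suc k) \<bullet> (E (Suc k) - E k))"
    unfolding Rk \<Lambda>_def by (simp add: inner_diff_right inner_add_right algebra_simps)
  have "0 \<noteq> \<alpha> + \<tau>" "\<beta> \<noteq> 0" using stepsizes \<beta>_pos by (auto simp: stepsizes_def)
  note ident = multiplier_energy_identity[OF this(1)[symmetric] this(2),
      where E = "E (Suc k)" and \<eta> = "\<eta> (Suc k)" and \<eta>' = "\<eta> k" and \<Lambda> = \<Lambda>]
  have R1: "E (Suc k) + \<eta> (Suc k) = R (Suc k)" by (simp add: R_def res)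
  have L: "\<Lambda> - (\<alpha> * \<beta>) *\<^sub>R s - (\<tau> * \<beta>) *\<^sub>R R (Suc k) = l (Suc k) - ls"
    using l_step[OF run, of k] by (simp add: \<Lambda>_def s_def R_def res)
  have ident': "- (E (Suc k) \<bullet> (\<beta> *\<^sub>R s - \<Lambda>)) - \<eta> (Suc k) \<bullet> ((\<alpha> * \<beta>) *\<^sub>R s + \<beta> *\<^sub>R R (Suc k) - \<Lambda>)
    = ((norm (l k - ls - (\<alpha> * \<beta>) *\<^sub>R \<eta> k))\<^sup>2
        - (norm (l (Suc k) - ls - (\<alpha> * \<beta>) *\<^sub>R \<eta> (Suc k)))\<^sup>2) / (2 * (\<alpha> + \<tau>) * \<beta>)
      + (1 - \<alpha>) * \<beta> / 2 * ((norm (\<eta> k))\<^sup>2 - (norm (\<eta> (Suc k)))\<^sup>2)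
      + \<beta> * (- (1 - (\<alpha> + \<tau>) / 2) * (norm (R (Suc k)))\<^sup>2 + (1 - \<alpha>) * (R (Suc k) \<bullet> \<delta> k)
             - (1 - \<alpha>) / 2 * (norm (\<delta> k))\<^sup>2)"
    using ident unfolding s_def[symmetric] R1 L \<delta>[symmetric] unfolding \<Lambda>_def .
  have sumpol: "(\<Sum>i\<in>{1..p}. e (Suc k) i \<bullet> (e (Suc k) i - e k i))
      = ((\<Sum>i\<in>{1..p}. (norm (e (Suc k) i))\<^sup>2) + (\<Sum>i\<in>{1..p}. (norm (e (Suc k) i - e k i))\<^sup>2)
          - (\<Sum>i\<in>{1..p}. (norm (e k i))\<^sup>2)) / 2"
    by (simp add: inner_diff_polarization sum_divide_distrib[symmetric] sum.distrib sum_subtractf)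
  have be: "block_energy (1 + \<mu>) (\<lambda>i. x j i - xs i)
      = Q (1 + \<mu>) j + \<beta> / 2 * (\<Sum>i\<in>{1..p}. (norm (e j i))\<^sup>2) - \<beta> / 2 * (norm (E j))\<^sup>2" for j
    by (simp add: block_energy_def Q_def e_def E_def sum.distrib sum_distrib_left)
  have bd: "block_energy (1 - \<mu>) (\<lambda>i. x (Suc k) i - x k i)
      = (\<Sum>i\<in>{1..p}. r i * (1 - \<mu>) / 2 * (norm (x (Suc k) i - x k i))\<^sup>2)
        + \<beta> / 2 * (\<Sum>i\<in>{1..p}. (norm (e (Suc k) i - e k i))\<^sup>2) - \<beta> / 2 * (norm (E (Suc k) - E k))\<^sup>2"
    unfolding block_energy_def DE unfolding De by (simp add: sum.distrib sum_distrib_left)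
  have lhs: "(\<Sum>i\<in>{1..p}. r i * ((1 + \<mu>) / 2 * ((norm (x (Suc k) i - xs i))\<^sup>2 - (norm (x k i - xs i))\<^sup>2)
           + (1 - \<mu>) / 2 * (norm (x (Suc k) i - x k i))\<^sup>2))
      = Q (1 + \<mu>) (Suc k) - Q (1 + \<mu>) k
        + (\<Sum>i\<in>{1..p}. r i * (1 - \<mu>) / 2 * (norm (x (Suc k) i - x k i))\<^sup>2)"
    unfolding Q_def sum_subtractf[symmetric] sum.distrib[symmetric]
    by (intro sum.cong refl) (simp add: algebra_simps)
  show ?thesis
    unfolding energy_def be bd \<eta>
    using X Yst VI rhs
    unfolding ident' lhs sumpol objective_def inner_diff_polarization[of "E (Suc k)" "E k"]
    by (simp add: distrib_left right_diff_distrib add_divide_distrib diff_divide_distrib)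
qed

section \<open>Decrease from the second iteration on\<close>

text \<open>The optimality conditions of two successive y-steps are tested with each other's
  solution and added, so that \<open>g\<close> cancels. The indices start at \<open>Suc k\<close>
  because both points must come from a y-step, which \<open>y 0\<close> does not.\<close>

lemma consecutive_y_steps:
  assumes run: "run x y l"
  defines "R \<equiv> \<lambda>k. res (x k) (y k)" and "\<delta> \<equiv> \<lambda>k. B *v (y (Suc k) - y k)"
  shows "(1 + \<alpha>) * (R (Suc (Suc k)) \<bullet> \<delta> (Suc k))
    \<le> (1 - \<tau>) * (\<delta> (Suc k) \<bullet> R (Suc k)) + \<alpha> * (norm (\<delta> (Suc k)))\<^sup>2"
proof -
  let ?R = "R (Suc k)" and ?R1 = "R (Suc (Suc k))" and ?d = "\<delta> (Suc k)"
    and ?h = "half_multiplier x y l k"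
  have s: "res (x (Suc (Suc k))) (y (Suc k)) = ?R1 - ?d"
    by (simp add: R_def \<delta>_def residual_def matrix_vector_mult_diff_distrib)
  have h: "half_multiplier x y l (Suc k) = ?h - (\<tau> * \<beta>) *\<^sub>R ?R - (\<alpha> * \<beta>) *\<^sub>R (?R1 - ?d)"
    unfolding s using l_step[OF run, of k] by (simp add: R_def)
  have neg: "B *v (y (Suc k) - y (Suc (Suc k))) = - ?d"
    by (simp add: \<delta>_def matrix_vector_mult_diff_distrib)
  have "0 \<le> g (y (Suc k)) - g (y (Suc (Suc k)))
      - ?d \<bullet> (\<beta> *\<^sub>R ?R1 - (?h - (\<tau> * \<beta>) *\<^sub>R ?R - (\<alpha> * \<beta>) *\<^sub>R (?R1 - ?d)))"
    using y_step_VI[OF run y_in_Y[OF run], of k "Suc k"] unfolding h neg by (simp add: R_def)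
  moreover have "0 \<le> g (y (Suc (Suc k))) - g (y (Suc k)) + ?d \<bullet> (\<beta> *\<^sub>R ?R - ?h)"
    using y_step_VI[OF run y_in_Y[OF run], of "Suc k" k] by (simp add: R_def \<delta>_def)
  ultimately have "0 \<le> ?d \<bullet> (\<beta> *\<^sub>R ?R - ?h)
      - ?d \<bullet> (\<beta> *\<^sub>R ?R1 - (?h - (\<tau> * \<beta>) *\<^sub>R ?R - (\<alpha> * \<beta>) *\<^sub>R (?R1 - ?d)))"
    by linarith
  also have "\<dots> = \<beta> * ((1 - \<tau>) * (?d \<bullet> ?R) + \<alpha> * (norm ?d)\<^sup>2 - (1 + \<alpha>) * (?R1 \<bullet> ?d))"
    unfolding power2_norm_eq_inner
    by (simp add: inner_diff_right inner_commute[of ?R1 ?d] algebra_simps)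
  finally show ?thesis using \<beta>_pos by (simp add: zero_le_mult_iff)
qed

lemma B_bounded_below:
  obtains c where "0 < c" "\<And>v. c * (norm v)\<^sup>2 \<le> (norm (B *v v))\<^sup>2"
proof -
  obtain c where c: "0 < c" "\<And>v. c * norm v \<le> norm (B *v v)"
    using linear_inj_bounded_below_pos[OF matrix_vector_mul_linear inj_B] by blast
  show thesis
  proof
    show "0 < c\<^sup>2" using c by simp
    show "c\<^sup>2 * (norm v)\<^sup>2 \<le> (norm (B *v v))\<^sup>2" for v
      using power_mono[OF c(2)[of v], of 2] c(1) by (simp add: power_mult_distrib)
  qed
qed

abbreviation step_size where
  "step_size x y k \<equiv> (\<Sum>i\<in>{1..p}. (norm (x (Suc k) i - x k i))\<^sup>2) + (norm (y (Suc k) - y k))\<^sup>2"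

lemma descent:
  obtains c\<^sub>1 c where "0 \<le> c\<^sub>1" "0 < c"
    "\<And>x y l k. run x y l \<Longrightarrow>
       c * step_size x y (Suc k)
        \<le> (energy (x (Suc k)) (y (Suc k)) (l (Suc k)) + c\<^sub>1 * (norm (res (x (Suc k)) (y (Suc k))))\<^sup>2)
        - (energy (x (Suc (Suc k))) (y (Suc (Suc k))) (l (Suc (Suc k)))
           + c\<^sub>1 * (norm (res (x (Suc (Suc k))) (y (Suc (Suc k)))))\<^sup>2)"
proof -
  obtain c\<^sub>1 c\<^sub>2 where c: "0 \<le> c\<^sub>1" "0 < c\<^sub>2"
    "\<And>R R' \<delta> :: real^'n.
      (1 + \<alpha>) * (R \<bullet> \<delta>) \<le> (1 - \<tau>) * (\<delta> \<bullet> R') + \<alpha> * (norm \<delta>)\<^sup>2 \<Longrightarrow>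
      - (1 - (\<alpha> + \<tau>) / 2) * (norm R)\<^sup>2 + (1 - \<alpha>) * (R \<bullet> \<delta>) - (1 - \<alpha>) / 2 * (norm \<delta>)\<^sup>2
        \<le> c\<^sub>1 * (norm R')\<^sup>2 - c\<^sub>1 * (norm R)\<^sup>2 - c\<^sub>2 * (norm \<delta>)\<^sup>2"
    by (rule pairing_negative_definite[OF stepsizes, where 'a = "real^'n"]) blast
  obtain c\<^sub>3 where c3: "0 < c\<^sub>3" "\<And>v. c\<^sub>3 * (\<Sum>i\<in>{1..p}. (norm (v i))\<^sup>2) \<le> block_energy (1 - \<mu>) v"
    by (rule block_energy_coerciveE) blast
  obtain c\<^sub>4 where c4: "0 < c\<^sub>4" "\<And>v. c\<^sub>4 * (norm v)\<^sup>2 \<le> (norm (B *v v))\<^sup>2"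
    by (rule B_bounded_below) blast
  \<comment> \<open>\<open>c\<^sub>3\<close> is the rate for the blocks; the rate for
    \<open>y\<close> passes through \<open>B\<close>, hence the factor
    \<open>c\<^sub>4\<close>.\<close>
  define c where "c = min c\<^sub>3 (\<beta> * c\<^sub>2 * c\<^sub>4)"
  show thesis
  proof
    show "0 \<le> \<beta> * c\<^sub>1" using c(1) \<beta>_pos by simp
    show "0 < c" using c(2) c3(1) c4(1) \<beta>_pos by (simp add: c_def)
    fix x y l k assume run: "run x y l"
    let ?X = "\<Sum>i\<in>{1..p}. (norm (x (Suc (Suc k)) i - x (Suc k) i))\<^sup>2"
      and ?Y = "(norm (y (Suc (Suc k)) - y (Suc k)))\<^sup>2"
      and ?d = "B *v (y (Suc (Suc k)) - y (Suc k))"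
      and ?R = "\<lambda>k. res (x k) (y k)"
    have "c * ?X \<le> c\<^sub>3 * ?X"
      by (intro mult_right_mono sum_nonneg) (auto simp: c_def)
    also have "\<dots> \<le> block_energy (1 - \<mu>) (\<lambda>i. x (Suc (Suc k)) i - x (Suc k) i)" by (rule c3(2))
    finally have X: "c * ?X \<le> block_energy (1 - \<mu>) (\<lambda>i. x (Suc (Suc k)) i - x (Suc k) i)" .
    have "c * ?Y \<le> \<beta> * c\<^sub>2 * c\<^sub>4 * ?Y" by (intro mult_right_mono) (auto simp: c_def)
    also have "\<dots> \<le> \<beta> * c\<^sub>2 * (norm ?d)\<^sup>2"
      using mult_left_mono[OF c4(2), of "\<beta> * c\<^sub>2"] \<beta>_pos c(2) by (simp add: mult.assoc)
    finally have Y: "c * ?Y \<le> \<beta> * c\<^sub>2 * (norm ?d)\<^sup>2" .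
    have "\<beta> * (- (1 - (\<alpha> + \<tau>) / 2) * (norm (?R (Suc (Suc k))))\<^sup>2 + (1 - \<alpha>) * (?R (Suc (Suc k)) \<bullet> ?d)
          - (1 - \<alpha>) / 2 * (norm ?d)\<^sup>2)
        \<le> \<beta> * (c\<^sub>1 * (norm (?R (Suc k)))\<^sup>2 - c\<^sub>1 * (norm (?R (Suc (Suc k))))\<^sup>2 - c\<^sub>2 * (norm ?d)\<^sup>2)"
      using consecutive_y_steps[OF run, of k] \<beta>_pos by (intro mult_left_mono c(3)) auto
    also have "\<dots> = \<beta> * c\<^sub>1 * (norm (?R (Suc k)))\<^sup>2 - \<beta> * c\<^sub>1 * (norm (?R (Suc (Suc k))))\<^sup>2
        - \<beta> * c\<^sub>2 * (norm ?d)\<^sup>2"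
      by (simp only: right_diff_distrib mult.assoc)
    finally show "c * step_size x y (Suc k)
        \<le> (energy (x (Suc k)) (y (Suc k)) (l (Suc k)) + \<beta> * c\<^sub>1 * (norm (?R (Suc k)))\<^sup>2)
        - (energy (x (Suc (Suc k))) (y (Suc (Suc k))) (l (Suc (Suc k)))
           + \<beta> * c\<^sub>1 * (norm (?R (Suc (Suc k))))\<^sup>2)"
      unfolding distrib_left using X Y energy_step[OF run, of "Suc k"] by linarith
  qed
qed

section \<open>Uniform summability and the rate\<close>

lemma energy_cong:
  assumes "\<And>i. i \<in> {1..p} \<Longrightarrow> x i = x' i"
  shows "energy x y l = energy x' y l"
  using assms by (simp add: energy_def block_energy_def)

text \<open>The bound is read off a reference run. Any other run from the same starting point shares
  its first iterate, hence also its first step and its energy at index 1, from where the telescoping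
  begins. If no run exists, any constant will do.\<close>

lemma sum_step_size_bounded:
  obtains \<theta> where "0 < \<theta>"
    "\<And>x y l n. run x y l \<Longrightarrow> (\<And>i. i \<in> {1..p} \<Longrightarrow> x 0 i = x0 i) \<Longrightarrow> y 0 = y0 \<Longrightarrow> l 0 = l0 \<Longrightarrow>
       (\<Sum>k<n. step_size x y k) \<le> \<theta>"
proof (cases "\<exists>x y l. run x y l \<and> (\<forall>i\<in>{1..p}. x 0 i = x0 i) \<and> y 0 = y0 \<and> l 0 = l0")
  case False
  show thesis
  proof (rule that[of 1])
    fix x y l n
    assume "run x y l" "\<And>i. i \<in> {1..p} \<Longrightarrow> x 0 i = x0 i" "y 0 = y0" "l 0 = l0"
    then show "(\<Sum>k<n. step_size x y k) \<le> 1" using False by blast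
  qed simp
next
  case True
  then obtain x\<^sub>1 y\<^sub>1 l\<^sub>1 where ref: "run x\<^sub>1 y\<^sub>1 l\<^sub>1" "\<And>i. i \<in> {1..p} \<Longrightarrow> x\<^sub>1 0 i = x0 i" "y\<^sub>1 0 = y0" "l\<^sub>1 0 = l0"
    by blast
  obtain c\<^sub>1 c where c: "0 \<le> c\<^sub>1" "0 < c"
    and descent: "\<And>x y l k. run x y l \<Longrightarrow>
       c * step_size x y (Suc k)
        \<le> (energy (x (Suc k)) (y (Suc k)) (l (Suc k)) + c\<^sub>1 * (norm (res (x (Suc k)) (y (Suc k))))\<^sup>2)
        - (energy (x (Suc (Suc k))) (y (Suc (Suc k))) (l (Suc (Suc k)))
           + c\<^sub>1 * (norm (res (x (Suc (Suc k))) (y (Suc (Suc k)))))\<^sup>2)"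
    by (rule descent) blast
  define W where "W x y l k = energy (x k) (y k) (l k) + c\<^sub>1 * (norm (res (x k) (y k)))\<^sup>2" for x y l and k :: nat
  have W0: "0 \<le> W x y l k" for x y l k
    unfolding W_def using c by (intro add_nonneg_nonneg energy_nonneg) auto
  show thesis
  \<comment> \<open>The first step is counted exactly, all later ones by the telescoped energy
    divided by the decrease rate; adding 1 makes the constant positive.\<close>
  proof (rule that[of "step_size x\<^sub>1 y\<^sub>1 0 + W x\<^sub>1 y\<^sub>1 l\<^sub>1 1 / c + 1"])
    have "0 \<le> step_size x\<^sub>1 y\<^sub>1 0 + W x\<^sub>1 y\<^sub>1 l\<^sub>1 1 / c"
      using W0 c by (intro add_nonneg_nonneg sum_nonneg divide_nonneg_pos) auto
    then show "0 < step_size x\<^sub>1 y\<^sub>1 0 + W x\<^sub>1 y\<^sub>1 l\<^sub>1 1 / c + 1" by simp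
    fix x y l n
    assume run: "run x y l" and start: "\<And>i. i \<in> {1..p} \<Longrightarrow> x 0 i = x0 i" "y 0 = y0" "l 0 = l0"
    have x0: "\<And>i. i \<in> {1..p} \<Longrightarrow> x 0 i = x\<^sub>1 0 i" and y0: "y 0 = y\<^sub>1 0" and l0: "l 0 = l\<^sub>1 0"
      using start ref by simp_all
    note x1 = first_x_step_unique[OF run ref(1) x0 y0 l0]
      and yl1 = first_step_unique[OF run ref(1) x0 y0 l0]
    have step0: "step_size x y 0 = step_size x\<^sub>1 y\<^sub>1 0"
      using x0 y0 x1 yl1 by simp
    have W1: "W x y l 1 = W x\<^sub>1 y\<^sub>1 l\<^sub>1 1"
      using energy_cong[of "x 1" "x\<^sub>1 1", OF x1] residual_cong[of "x 1" "x\<^sub>1 1", OF x1] yl1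
      unfolding W_def by simp
    have "c * (\<Sum>k<n. step_size x y (Suc k)) \<le> (\<Sum>k<n. W x y l (Suc k) - W x y l (Suc (Suc k)))"
      unfolding sum_distrib_left W_def by (intro sum_mono descent run)
    also have "\<dots> = W x y l 1 - W x y l (Suc n)"
      by (subst sum_lessThan_telescope') simp
    also have "\<dots> \<le> W x\<^sub>1 y\<^sub>1 l\<^sub>1 1" using W0[of x y l "Suc n"] W1 by simp
    finally have tail: "(\<Sum>k<n. step_size x y (Suc k)) \<le> W x\<^sub>1 y\<^sub>1 l\<^sub>1 1 / c"
      using c by (simp add: pos_le_divide_eq mult.commute)
    \<comment> \<open>One more nonnegative term is added so that the first step can be split off
      even when \<open>n = 0\<close>.\<close>
    have "(\<Sum>k<n. step_size x y k) \<le> (\<Sum>k<Suc n. step_size x y k)"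
      by (intro sum_mono2) (auto intro!: add_nonneg_nonneg sum_nonneg)
    also have "\<dots> = step_size x y 0 + (\<Sum>k<n. step_size x y (Suc k))"
      by (rule sum.lessThan_Suc_shift)
    finally show "(\<Sum>k<n. step_size x y k) \<le> step_size x\<^sub>1 y\<^sub>1 0 + W x\<^sub>1 y\<^sub>1 l\<^sub>1 1 / c + 1"
      using tail step0 by linarith
  qed
qed

end

theorem theorem6:
  fixes p :: nat
    and I :: "nat \<Rightarrow> 'm::finite set"
    and A :: "nat \<Rightarrow> real^'m^'n::finite"
    and B :: "real^'d::finite^'n"
    and b :: "real^'n"
    and f :: "nat \<Rightarrow> real^'m \<Rightarrow> real"
    and g :: "real^'d \<Rightarrow> real"
    and Y :: "(real^'d) set"
    and \<beta> \<mu> \<alpha> \<tau> \<gamma> :: real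
    and r :: "nat \<Rightarrow> real"
    and x0 :: "nat \<Rightarrow> real^'m" and y0 :: "real^'d" and l0 :: "real^'n"
  assumes "p \<ge> 1"
    and "\<And>i. i \<in> {1..p} \<Longrightarrow> I i \<noteq> {}"
    and "\<And>i j. i \<in> {1..p} \<Longrightarrow> j \<notin> I i \<Longrightarrow> column j (A i) = 0"
    and "\<And>i. i \<in> {1..p} \<Longrightarrow> rank (A i) = card (I i)"
    and "rank B = CARD('d)"
    and "\<And>i. i \<in> {1..p} \<Longrightarrow> closed_proper_convex_on (orthant (I i)) (f i)"
    and "closed_proper_convex_on UNIV g"
    and "closed Y" and "convex Y"
    and "solutions p I A B b f g Y \<noteq> {}"
    and "VI_solutions p I A B b f g Y \<noteq> {}"
    and "\<beta> > 0" and "0 < \<mu>" and "\<mu> < 1"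
    and "(\<alpha>, \<tau>) \<in> stepsizes"
    and "\<And>i. i \<in> {1..p} \<Longrightarrow> r i > 0"
    and "\<gamma> > (real p - 1) / (1 - \<mu>)"
    and "\<And>i. i \<in> {1..p} \<Longrightarrow> r i \<ge> \<gamma> * \<beta> * onorm ((*v) (transpose (A i) ** A i))"
    and "\<And>i. i \<in> {1..p} \<Longrightarrow> x0 i \<in> pos_orthant (I i)"
  shows "\<exists>\<theta>>0. \<forall>x y l. admm_lqp p I A B b f g Y \<beta> \<mu> r \<alpha> \<tau> x0 y0 l0 x y l \<longrightarrow>
           (\<forall>k::nat>0. \<exists>t\<in>{1..k}.
              (\<Sum>i\<in>{1..p}. (norm (x t i - x (t - 1) i))\<^sup>2) \<le> \<theta> / real k \<and>
              (norm (y t - y (t - 1)))\<^sup>2 \<le> \<theta> / real k)"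
proof -
  obtain xs ys ls where saddle: "(xs, ys, ls) \<in> VI_solutions p I A B b f g Y"
    using assms(11) by (metis ex_in_conv prod_cases3)
  interpret admm_lqp_setting p I A B b f g Y \<beta> \<mu> \<alpha> \<tau> r \<gamma> xs ys ls
  proof
    show "convex_on Y g"
      using assms(7) \<open>convex Y\<close> by (auto simp: closed_proper_convex_on_def intro: convex_on_subset)
    show "inj ((*v) B)" using assms(5) by (simp add: full_rank_injective)
  qed (use assms saddle in \<open>auto simp: closed_proper_convex_on_def\<close>)
  obtain \<theta> where \<theta>: "0 < \<theta>"
    "\<And>x y l n. run x y l \<Longrightarrow> (\<And>i. i \<in> {1..p} \<Longrightarrow> x 0 i = x0 i) \<Longrightarrow> y 0 = y0 \<Longrightarrow> l 0 = l0 \<Longrightarrow>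
       (\<Sum>k<n. step_size x y k) \<le> \<theta>"
    by (rule sum_step_size_bounded[of x0 y0 l0]) blast
  show ?thesis
  proof (intro exI[of _ \<theta>] conjI allI impI \<theta>(1))
    fix x y l and k :: nat
    assume admm: "admm_lqp p I A B b f g Y \<beta> \<mu> r \<alpha> \<tau> x0 y0 l0 x y l" and k: "0 < k"
    have start: "\<And>i. i \<in> {1..p} \<Longrightarrow> x 0 i = x0 i" "y 0 = y0" "l 0 = l0"
      using admm unfolding admm_lqp_def by blast+
    have "run x y l"
      using admm assms(19) unfolding admm_lqp_def by simp
    then have sum: "(\<Sum>j<k. step_size x y j) \<le> \<theta>"
      using start by (rule \<theta>(2))
    \<comment> \<open>Some step is at most the average. As \<open>step_size\<close> adds the x-part
      and the y-part, a single index serves both bounds, with \<open>t = Suc j\<close>.\<close>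
    have "\<exists>j<k. step_size x y j \<le> \<theta> / real k"
    proof (rule ccontr)
      assume "\<not> ?thesis"
      then have "(\<Sum>j<k. \<theta> / real k) < (\<Sum>j<k. step_size x y j)"
        using k by (intro sum_strict_mono) auto
      then show False using sum k by simp
    qed
    then obtain j where j: "j < k" "step_size x y j \<le> \<theta> / real k" by blast
    have "0 \<le> (\<Sum>i\<in>{1..p}. (norm (x (Suc j) i - x j i))\<^sup>2)" by (intro sum_nonneg) auto
    then have "(norm (y (Suc j) - y j))\<^sup>2 \<le> \<theta> / real k" using j(2) by linarith
    moreover have "(\<Sum>i\<in>{1..p}. (norm (x (Suc j) i - x j i))\<^sup>2) \<le> \<theta> / real k"
      using j(2) zero_le_power2[of "norm (y (Suc j) - y j)"] by linarith
    ultimately show "\<exists>t\<in>{1..k}. (\<Sum>i\<in>{1..p}. (norm (x t i - x (t - 1) i))\<^sup>2) \<le> \<theta> / real k \<and>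
        (norm (y t - y (t - 1)))\<^sup>2 \<le> \<theta> / real k"
      using j(1) by (intro bexI[of _ "Suc j"]) auto
  qed
qed

end
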